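(* The basis of $\mathrm{NSym}$ dual to the scaled quasipowersum basis $(\widetilde P_\beta)_\beta$ of $\mathrm{QSym}$ is the Zassenhaus basis $(\mathbf{Z}_\alpha)_\alpha$; that is, $\langle\mathbf{Z}_\alpha,\widetilde P_\beta\rangle=\delta_{\alpha\beta}$ for all compositions $\alpha,\beta$.
   Context: All algebras are over $\mathbb{Q}$. A composition is a finite (possibly empty) sequence of positive integers; $m_i(\alpha)$ is the number of parts of $\alpha$ equal to $i$; $\alpha\le\beta$ means that $\beta$ is obtained from $\alpha$ by summing groups of consecutive parts (i.e. $\alpha$ refines $\beta$). $\mathrm{QSym}$ has monomial basis $M_\alpha=\sum_{i_1<\cdots<i_k}x_{i_1}^{a_1}\cdots x_{i_k}^{a_k}$. If $\alpha\le\beta=(b_1,\dots,b_l)$, write uniquely $\alpha$ as the concatenation $\alpha^{(1)}|\cdots|\alpha^{(l)}$ with $\alpha^{(j)}$ a composition of $b_j$, and put $c_i(\alpha,\beta)!=\prod_{j=1}^l m_i(\alpha^{(j)})!$ and $C_{\alpha\beta}=\prod_{i\ge1}\frac{m_i(\alpha)!}{c_i(\alpha,\beta)!}$. Let $C(\alpha)$ be the composition obtained from $\alpha=(a_1,\dots,a_k)$ by breaking it at every strict ascent $a_i<a_{i+1}$ and replacing each resulting (maximal weakly decreasing) run of consecutive parts by its sum. The quasisymmetric powersum function is $P_\alpha=\sum_{\alpha\le\beta\le C(\alpha)}C_{\alpha\beta}M_\beta$. With $z_\alpha=\prod_i i^{m_i(\alpha)}m_i(\alpha)!$, the scaled quasipowersum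 is $\widetilde P_\alpha=\frac1{z_\alpha}P_\alpha$. $\mathrm{NSym}$ is the free associative algebra on generators $\mathbf{S}_1,\mathbf{S}_2,\dots$ ($\mathbf{S}_0=1$), graded by $\deg \mathbf{S}_k=k$, with complete basis $\mathbf{S}_\alpha=\mathbf{S}_{a_1}\cdots\mathbf{S}_{a_k}$, and it is the graded dual of $\mathrm{QSym}$ via $\langle\mathbf{S}_\alpha,M_\beta\rangle=\delta_{\alpha\beta}$. The Zassenhaus elements $\mathbf{Z}_i$ ($i\ge1$, homogeneous of degree $i$) are defined by $$\sum_{k\ge0}t^k\mathbf{S}_k=\cdots\exp\!\Big(\tfrac{\mathbf{Z}_i}{i}t^i\Big)\cdots\exp\!\Big(\tfrac{\mathbf{Z}_2}{2}t^2\Big)\exp\!\Big(\tfrac{\mathbf{Z}_1}{1}t\Big)$$ ($t$ a central variable; factors ordered with decreasing index from left to right), and $\mathbf{Z}_\alpha=\mathbf{Z}_{a_1}\mathbf{Z}_{a_2}\cdots\mathbf{Z}_{a_k}$ for $\alpha=(a_1,\dots,a_k)$. *)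

theory Defs
  imports
    "HOL-Computational_Algebra.Formal_Power_Series"
    "HOL-Library.Poly_Mapping"
    "HOL-Library.Function_Algebras"
begin

section \<open>Compositions\<close>

typedef composition = "{xs :: nat list. \<forall>x\<in>set xs. 1 \<le> x}"
  morphisms parts Composition
  by (rule exI[of _ "[]"]) simp

setup_lifting type_definition_composition

text \<open>Compositions form the free monoid on the positive integers; it is written additively
  (concatenation is \<open>+\<close>, the empty composition is \<open>0\<close>), as \<^theory>\<open>HOL-Library.Poly_Mapping\<close>
  requires of the exponents of a monoid algebra.\<close>

instantiation composition :: monoid_add
begin
lift_definition zero_composition :: composition is "[]" by simp
lift_definition plus_composition :: "composition \<Rightarrow> composition \<Rightarrow> composition" is "(@)" by auto
instance by standard (transfer, simp)+
end

definition weight :: "composition \<Rightarrow> nat"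
  where "weight \<alpha> = sum_list (parts \<alpha>)"

definition part_mult :: "nat \<Rightarrow> composition \<Rightarrow> nat"
  where "part_mult i \<alpha> = count_list (parts \<alpha>) i"

text \<open>\<open>splitting \<alpha> \<beta> [\<alpha>\<^sub>1, \<dots>, \<alpha>\<^sub>l]\<close>: \<open>\<alpha>\<close> is the concatenation of the \<open>\<alpha>\<^sub>j\<close>, and \<open>\<alpha>\<^sub>j\<close> is a
  composition of the \<open>j\<close>-th part of \<open>\<beta>\<close>.\<close>

definition splitting :: "composition \<Rightarrow> composition \<Rightarrow> composition list \<Rightarrow> bool"
  where "splitting \<alpha> \<beta> as \<longleftrightarrow> sum_list as = \<alpha> \<and> map weight as = parts \<beta>"

definition refines :: "composition \<Rightarrow> composition \<Rightarrow> bool"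
  where "refines \<alpha> \<beta> \<longleftrightarrow> (\<exists>as. splitting \<alpha> \<beta> as)"

definition blocks :: "composition \<Rightarrow> composition \<Rightarrow> composition list"
  where "blocks \<alpha> \<beta> = (THE as. splitting \<alpha> \<beta> as)"

definition c_fact :: "nat \<Rightarrow> composition \<Rightarrow> composition \<Rightarrow> nat"
  where "c_fact i \<alpha> \<beta> = (\<Prod>\<alpha>'\<leftarrow>blocks \<alpha> \<beta>. fact (part_mult i \<alpha>'))"

text \<open>In the next product, and in that for \<open>z\<^sub>\<alpha>\<close> below, the factors for the \<open>i\<close> that are not
  parts of \<open>\<alpha>\<close> are \<open>1\<close>.\<close>

definition C_coeff :: "composition \<Rightarrow> composition \<Rightarrow> rat"
  where "C_coeff \<alpha> \<beta> = (\<Prod>i\<in>set (parts \<alpha>). fact (part_mult i \<alpha>) / of_nat (c_fact i \<alpha> \<beta>))"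

definition z_coeff :: "composition \<Rightarrow> rat"
  where "z_coeff \<alpha> = (\<Prod>i\<in>set (parts \<alpha>). of_nat i ^ part_mult i \<alpha> * fact (part_mult i \<alpha>))"

fun descending_runs :: "nat list \<Rightarrow> nat list list" where
  "descending_runs [] = []"
| "descending_runs [a] = [[a]]"
| "descending_runs (a # b # xs) =
     (if a < b then [a] # descending_runs (b # xs)
      else (a # hd (descending_runs (b # xs))) # tl (descending_runs (b # xs)))"

definition C_comp :: "composition \<Rightarrow> composition"
  where "C_comp \<alpha> = Composition (map sum_list (descending_runs (parts \<alpha>)))"


section \<open>Quasisymmetric functions\<close>

text \<open>A formal power series over the rationals in countably many variables, as the function
  giving the coefficient of each monomial; a monomial is its exponent vector. The variables
  are numbered from \<open>0\<close>. Addition of series is that of \<^theory>\<open>HOL-Library.Function_Algebras\<close>;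
  the pointwise product of that theory is not the product of series and is not used.\<close>

type_synonym monom = "nat \<Rightarrow>\<^sub>0 nat"
type_synonym series = "monom \<Rightarrow> rat"

definition series_scale :: "rat \<Rightarrow> series \<Rightarrow> series"
  where "series_scale c f = (\<lambda>m. c * f m)"

interpretation series: vector_space series_scale
  by standard (auto simp: series_scale_def algebra_simps)

definition index_seqs :: "composition \<Rightarrow> nat list set"
  where "index_seqs \<alpha> = {is. sorted_wrt (<) is \<and> length is = length (parts \<alpha>)}"

definition monom_at :: "composition \<Rightarrow> nat list \<Rightarrow> monom"
  where "monom_at \<alpha> is = sum_list (map2 Poly_Mapping.single is (parts \<alpha>))"

definition monom_degree :: "monom \<Rightarrow> nat"
  where "monom_degree m = (\<Sum>i\<in>Poly_Mapping.keys m. Poly_Mapping.lookup m i)"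

definition QSym :: "series set"
  where "QSym = {f. (\<exists>d. \<forall>m. f m \<noteq> 0 \<longrightarrow> monom_degree m \<le> d) \<and>
    (\<forall>\<alpha>. \<forall>is\<in>index_seqs \<alpha>. \<forall>js\<in>index_seqs \<alpha>. f (monom_at \<alpha> is) = f (monom_at \<alpha> js))}"

text \<open>The coefficient of \<open>m\<close> in the formal sum of the monomials \<open>monom_at \<alpha> is\<close> over all index
  sequences \<open>is\<close> is the number of \<open>is\<close> with \<open>monom_at \<alpha> is = m\<close>.\<close>

definition M_basis :: "composition \<Rightarrow> series"
  where "M_basis \<alpha> = (\<lambda>m. of_nat (card {is \<in> index_seqs \<alpha>. monom_at \<alpha> is = m}))"

lemma M_basis_monom_at:
  assumes "js \<in> index_seqs \<beta>"
  shows "M_basis \<alpha> (monom_at \<beta> js) = (if \<alpha> = \<beta> then 1 else 0)"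
proof -
  have lookup_at: "Poly_Mapping.lookup (sum_list (map2 Poly_Mapping.single is as)) x =
      (case map_of (zip is as) x of None \<Rightarrow> 0 | Some a \<Rightarrow> a)"
    if "length is = length as" "distinct is" for "is" :: "nat list" and as :: "nat list" and x
    using that
    by (induction "is" as rule: list_induct2)
      (auto simp: lookup_add lookup_single when_def map_of_zip_is_None
        split: option.split dest!: map_of_SomeD set_zip_leftD)
  have eq: "is = js \<and> \<alpha> = \<beta>"
    if is_seq: "is \<in> index_seqs \<alpha>" and js_seq: "js \<in> index_seqs \<beta>"
      and eq: "monom_at \<alpha> is = monom_at \<beta> js" for \<alpha> \<beta> "is" js
  proof -
    have srt: "sorted_wrt (<) is" "length is = length (parts \<alpha>)"
      "sorted_wrt (<) js" "length js = length (parts \<beta>)"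
      using is_seq js_seq by (auto simp: index_seqs_def)
    then have dist: "distinct is" "distinct js" by (simp_all add: strict_sorted_iff)
    have supp: "{x. Poly_Mapping.lookup (monom_at \<alpha> is) x \<noteq> 0} = set is"
      if "length is = length (parts \<alpha>)" "distinct is" for \<alpha> "is"
    proof -
      have "(case map_of (zip is (parts \<alpha>)) x of None \<Rightarrow> 0 | Some a \<Rightarrow> a) \<noteq> 0 \<longleftrightarrow> x \<in> set is" for x
        using parts[of \<alpha>] that(1)
        by (fastforce split: option.splits simp: map_of_zip_is_None
            dest!: map_of_SomeD elim!: in_set_zipE)
      then show ?thesis
        unfolding monom_at_def lookup_at[OF that] by blast
    qed
    have "set is = set js"
      using supp[of "is" \<alpha>] supp[of js \<beta>] eq srt dist by simp
    then have 1: "is = js"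
      using srt dist by (metis sorted_distinct_set_unique strict_sorted_iff)
    have "parts \<alpha> = parts \<beta>"
    proof (rule nth_equalityI)
      show "length (parts \<alpha>) = length (parts \<beta>)" using 1 srt by simp
      fix i assume i: "i < length (parts \<alpha>)"
      have at: "Poly_Mapping.lookup (monom_at \<gamma> is) (is ! i) = parts \<gamma> ! i"
        if "length is = length (parts \<gamma>)" for \<gamma>
        using i srt dist that
        by (simp add: monom_at_def lookup_at map_of_zip_nth)
      show "parts \<alpha> ! i = parts \<beta> ! i"
        using at[of \<alpha>] at[of \<beta>] srt eq 1 by simp
    qed
    with 1 show ?thesis by (simp add: parts_inject)
  qed
  have "{is \<in> index_seqs \<alpha>. monom_at \<alpha> is = monom_at \<beta> js} = (if \<alpha> = \<beta> then {js} else {})"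
    using eq[OF _ assms] assms by auto
  then show ?thesis by (simp add: M_basis_def)
qed

lemma index_seqs_nonempty: "[0..<length (parts \<alpha>)] \<in> index_seqs \<alpha>"
  by (simp add: index_seqs_def)

lemma inj_M_basis: "inj M_basis"
proof (rule injI)
  fix \<alpha> \<beta> assume "M_basis \<alpha> = M_basis \<beta>"
  then show "\<alpha> = \<beta>"
    using M_basis_monom_at[OF index_seqs_nonempty[of \<beta>], of \<alpha>]
      M_basis_monom_at[OF index_seqs_nonempty[of \<beta>], of \<beta>] by (auto split: if_splits)
qed

lemma independent_M_basis: "series.independent (range M_basis)"
proof
  assume "series.dependent (range M_basis)"
  then obtain T u where T: "finite T" "T \<subseteq> range M_basis"
      and sum0: "(\<Sum>v\<in>T. series_scale (u v) v) = 0" and "\<exists>v\<in>T. u v \<noteq> 0"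
    unfolding series.dependent_explicit by blast
  then obtain \<beta> where \<beta>: "M_basis \<beta> \<in> T" "u (M_basis \<beta>) \<noteq> 0" by blast
  define m where "m = monom_at \<beta> [0..<length (parts \<beta>)]"
  have at_m: "v m = (if v = M_basis \<beta> then 1 else 0)" if v: "v \<in> T" for v
  proof -
    obtain \<alpha> where "v = M_basis \<alpha>" using v T(2) by blast
    then show ?thesis
      using M_basis_monom_at[OF index_seqs_nonempty] inj_M_basis by (auto simp: m_def inj_eq)
  qed
  have sum_at: "(\<Sum>v\<in>T'. series_scale (u v) v) m = (\<Sum>v\<in>T'. u v * v m)" if "finite T'" for T'
    using that by (induction T') (auto simp: series_scale_def)
  have "0 = (\<Sum>v\<in>T. u v * v m)"
    using sum_at[OF T(1)] sum0 by simp
  also have "\<dots> = (\<Sum>v\<in>T. if v = M_basis \<beta> then u v else 0)"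
    by (rule sum.cong) (auto simp: at_m)
  also have "\<dots> = u (M_basis \<beta>)"
    using T(1) \<beta>(1) by simp
  finally show False using \<beta>(2) by simp
qed

definition quasipowersum :: "composition \<Rightarrow> series"
  where "quasipowersum \<alpha> =
    (\<Sum>\<beta> | refines \<alpha> \<beta> \<and> refines \<beta> (C_comp \<alpha>). series_scale (C_coeff \<alpha> \<beta>) (M_basis \<beta>))"

definition scaled_quasipowersum :: "composition \<Rightarrow> series"
  where "scaled_quasipowersum \<alpha> = series_scale (1 / z_coeff \<alpha>) (quasipowersum \<alpha>)"


section \<open>Noncommutative symmetric functions\<close>

text \<open>The free associative algebra is the monoid algebra of the free monoid: the word
  \<open>S\<^sub>a\<^sub>1 \<cdots> S\<^sub>a\<^sub>k\<close> is the composition \<open>(a\<^sub>1, \<dots>, a\<^sub>k)\<close>.\<close>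

type_synonym nsym = "composition \<Rightarrow>\<^sub>0 rat"

definition nsym_scale :: "rat \<Rightarrow> nsym \<Rightarrow> nsym"
  where "nsym_scale c F = Poly_Mapping.map ((*) c) F"

lemma lookup_nsym_scale [simp]: "Poly_Mapping.lookup (nsym_scale c F) \<alpha> = c * Poly_Mapping.lookup F \<alpha>"
  by (simp add: nsym_scale_def Poly_Mapping.map.rep_eq when_def)

interpretation nsym: vector_space nsym_scale
  by standard (auto intro!: poly_mapping_eqI simp: lookup_add algebra_simps)

definition S_gen :: "nat \<Rightarrow> nsym"
  where "S_gen k = (if k = 0 then 1 else Poly_Mapping.single (Composition [k]) 1)"

definition S_basis :: "composition \<Rightarrow> nsym"
  where "S_basis \<alpha> = prod_list (map S_gen (parts \<alpha>))"

lemma S_basis_eq_single: "S_basis \<alpha> = Poly_Mapping.single \<alpha> 1"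
proof -
  have "prod_list (map S_gen xs) = Poly_Mapping.single (Composition xs) 1"
    if "\<forall>x\<in>set xs. 1 \<le> x" for xs
    using that
  proof (induction xs)
    case Nil
    have "Composition [] = 0" by (simp add: zero_composition_def)
    then show ?case by simp
  next
    case (Cons a xs)
    have "Composition [a] + Composition xs = Composition (a # xs)"
      using Cons.prems by (subst plus_composition.abs_eq) (auto simp: eq_onp_def)
    with Cons show ?case by (simp add: S_gen_def mult_single)
  qed
  from this[of "parts \<alpha>"] show ?thesis
    using parts[of \<alpha>] by (simp add: S_basis_def parts_inverse)
qed

text \<open>The pairing with \<open>\<langle>S\<^sub>\<alpha>, M\<^sub>\<beta>\<rangle> = \<delta>\<^sub>\<alpha>\<^sub>\<beta>\<close>, defined for \<open>G \<in> QSym\<close>: by the previous lemma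
  \<open>lookup F \<alpha>\<close> is the coordinate of \<open>F\<close> at \<open>S\<^sub>\<alpha>\<close>, and the second factor is the coordinate of \<open>G\<close>
  at \<open>M\<^sub>\<alpha>\<close>.\<close>

definition pairing :: "nsym \<Rightarrow> series \<Rightarrow> rat" where
  "pairing F G =
    (\<Sum>\<alpha>\<in>Poly_Mapping.keys F. Poly_Mapping.lookup F \<alpha> *
      series.representation (range M_basis) G (M_basis \<alpha>))"

lemma pairing_S_basis_M_basis: "pairing (S_basis \<alpha>) (M_basis \<beta>) = (if \<alpha> = \<beta> then 1 else 0)"
  using inj_M_basis
  by (simp add: pairing_def S_basis_eq_single series.representation_basis[OF independent_M_basis]
      inj_eq)

text \<open>Formal power series over the noncommutative ring \<^typ>\<open>nsym\<close>; \<^const>\<open>fps_X\<close> is the central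
  variable \<open>t\<close>. Infinite sums and limits are those of the \<open>t\<close>-adic topology, so
  \<open>nsym_exp f\<close> is meaningful when \<open>f\<close> has zero constant term.\<close>

definition nsym_exp :: "nsym fps \<Rightarrow> nsym fps"
  where "nsym_exp f = suminf (\<lambda>n. fps_const (nsym_scale (1 / fact n) 1) * f ^ n)"

definition zassenhaus_partial :: "(nat \<Rightarrow> nsym) \<Rightarrow> nat \<Rightarrow> nsym fps" where
  "zassenhaus_partial Z n =
    prod_list (map (\<lambda>i. nsym_exp (fps_const (nsym_scale (1 / of_nat i) (Z i)) * fps_X ^ i))
      (rev [1..<Suc n]))"

definition homogeneous :: "nat \<Rightarrow> nsym \<Rightarrow> bool"
  where "homogeneous d F \<longleftrightarrow> (\<forall>\<alpha>\<in>Poly_Mapping.keys F. weight \<alpha> = d)"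

text \<open>The unused value at index \<open>0\<close> is set to \<open>0\<close>, so that the sequence is unique.\<close>

definition Z_gen :: "nat \<Rightarrow> nsym" where
  "Z_gen = (THE Z. Z 0 = 0 \<and> (\<forall>i\<ge>1. homogeneous i (Z i)) \<and>
    zassenhaus_partial Z \<longlonglongrightarrow> Abs_fps S_gen)"

definition Z_basis :: "composition \<Rightarrow> nsym"
  where "Z_basis \<alpha> = prod_list (map Z_gen (parts \<alpha>))"


definition basis_family :: "(rat \<Rightarrow> 'v \<Rightarrow> 'v) \<Rightarrow> 'v::ab_group_add set \<Rightarrow> ('i \<Rightarrow> 'v) \<Rightarrow> bool" where
  "basis_family scale V b \<longleftrightarrow>
    inj b \<and> \<not> module.dependent scale (range b) \<and> module.span scale (range b) = V"

end

theory Submission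
  imports Defs
begin

text \<open>
  Reading the Zassenhaus product off coefficientwise gives
  \<open>S\<^sub>n = \<Sum>\<^sub>\<lambda> Z\<^sub>\<lambda> / z\<^sub>\<lambda>\<close>, the sum being over the weakly decreasing compositions \<open>\<lambda>\<close> of \<open>n\<close>.
  Multiplying out, \<open>S\<^sub>\<beta>\<close> is the sum of \<open>Z\<^sub>\<alpha> / \<Prod>\<^sub>j z(\<alpha>\<^sub>j)\<close> over the refinements \<open>\<alpha> = \<alpha>\<^sub>1 \<cdots> \<alpha>\<^sub>l\<close> of \<open>\<beta>\<close> all of
  whose blocks are weakly decreasing, that is, over \<open>\<alpha> \<le> \<beta> \<le> C(\<alpha>)\<close>, and the coefficient of \<open>Z\<^sub>\<alpha>\<close> is
  \<open>C\<^sub>\<alpha>\<^sub>\<beta> / z\<^sub>\<alpha>\<close>, the coefficient of \<open>M\<^sub>\<beta>\<close> in the scaled quasipowersum of \<open>\<alpha>\<close>. The same matrix thus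
  expresses \<open>S\<close> in \<open>Z\<close> and, transposed, the scaled quasipowersums in \<open>M\<close>. It is triangular for
  refinement with nonzero diagonal, so the duality of \<open>S\<close> and \<open>M\<close> is transported to \<open>Z\<close> and the
  scaled quasipowersums.
\<close>

section \<open>Zassenhaus factorisation\<close>

lemma nsym_scale_conv_mult: "nsym_scale c F = Poly_Mapping.single 0 c * F"
  by (simp add: nsym_scale_def mult_map_scale_conv_mult)

lemma nsym_scale_mult_left: "nsym_scale c F * G = nsym_scale c (F * G)"
  by (simp add: nsym_scale_conv_mult mult.assoc)

lemma poly_mapping_sum_single:
  "(\<Sum>k\<in>Poly_Mapping.keys p. Poly_Mapping.single k (Poly_Mapping.lookup p k)) = p"
proof (rule poly_mapping_eqI)
  fix x
  show "Poly_Mapping.lookup (\<Sum>k\<in>Poly_Mapping.keys p. Poly_Mapping.single k (Poly_Mapping.lookup p k)) x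
      = Poly_Mapping.lookup p x"
    by (simp add: lookup_sum lookup_single when_def in_keys_iff)
qed

text \<open>Scalars are the multiples of the empty word. It commutes with every word, and every
  element is a finite combination of words, so scalars are central.\<close>

lemma nsym_single_zero_commute: "F * Poly_Mapping.single 0 c = Poly_Mapping.single 0 c * (F :: nsym)"
  by (subst (1 2) poly_mapping_sum_single[of F, symmetric])
    (simp add: sum_distrib_left sum_distrib_right mult_single mult.commute)

lemma nsym_scale_mult_right: "F * nsym_scale c G = nsym_scale c (F * G)"
  unfolding nsym_scale_conv_mult
  by (metis mult.assoc nsym_single_zero_commute)

lemma nsym_scale_power: "nsym_scale c F ^ k = nsym_scale (c ^ k) (F ^ k)"
  by (induction k) (simp_all add: nsym_scale_mult_left nsym_scale_mult_right)

lemma nsym_scale_exp_term: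
  "nsym_scale (1 / fact k) (nsym_scale (1 / a) F ^ k) = nsym_scale (1 / (a ^ k * fact k)) (F ^ k)"
  by (simp add: nsym_scale_power power_one_over mult.commute)

text \<open>The coefficient ring need not be commutative; the powers can be collected because
  \<open>fps_X\<close> is central.\<close>

lemma fps_const_mult_X_power: "(fps_const z * fps_X ^ i) ^ k = fps_const (z ^ k) * (fps_X :: 'a::ring_1 fps) ^ (i * k)"
proof (induction k)
  case (Suc k)
  have "(fps_const z * fps_X ^ i) ^ Suc k
      = fps_const z * (fps_X ^ i * fps_const (z ^ k)) * fps_X ^ (i * k)"
    using Suc by (simp add: mult.assoc)
  also have "\<dots> = fps_const z * fps_const (z ^ k) * (fps_X ^ i * fps_X ^ (i * k))"
    by (simp only: fps_mult_fps_X_power_commute[of i "fps_const (z ^ k)"] mult.assoc)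
  finally show ?case by (simp add: power_add)
qed simp

text \<open>The \<open>k\<close>-th term of the exponential series lives in degree
  \<open>i * k\<close> alone. As \<open>i\<close> is positive, a given degree meets at most one
  term.\<close>

lemma nsym_exp_nth:
  assumes "0 < i"
  shows "fps_nth (nsym_exp (fps_const z * fps_X ^ i)) n =
    (if i dvd n then nsym_scale (1 / fact (n div i)) (z ^ (n div i)) else 0)"
proof -
  let ?e = "Abs_fps (\<lambda>n. if i dvd n then nsym_scale (1 / fact (n div i)) (z ^ (n div i)) else 0)"
  let ?t = "\<lambda>k. fps_const (nsym_scale (1 / fact k) 1) * (fps_const z * fps_X ^ i) ^ k"
  have t: "fps_nth (?t k) m = (if m = i * k then nsym_scale (1 / fact k) (z ^ k) else 0)" for k m
    by (simp add: fps_const_mult_X_power mult.assoc nsym_scale_mult_left)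
  have "?t sums ?e"
    unfolding sums_def
  proof (rule tendsto_fpsI)
    fix m
    \<comment> \<open>The partial sums are constant in degree \<open>m\<close> once
      \<open>N > m\<close>, since the only possible contributor is
      \<open>k = m div i\<close>.\<close>
    show "\<forall>\<^sub>F N in sequentially. fps_nth (\<Sum>k<N. ?t k) m = fps_nth ?e m"
      using eventually_gt_at_top[of m]
    proof eventually_elim
      case (elim N)
      have "m = i * k \<longleftrightarrow> k = m div i \<and> i dvd m" for k
        using assms by auto
      then have "fps_nth (\<Sum>k<N. ?t k) m = (\<Sum>k<N. if k = m div i then fps_nth ?e m else 0)"
        unfolding fps_sum_nth t by (intro sum.cong refl) simp
      moreover have "m div i < N"
        using elim by (rule le_less_trans[OF div_le_dividend])
      ultimately show ?case by (simp only: sum.delta finite_lessThan lessThan_iff if_True)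
    qed
  qed
  then have "nsym_exp (fps_const z * fps_X ^ i) = ?e"
    unfolding nsym_exp_def by (rule sums_unique[symmetric])
  then show ?thesis by (simp only: fps_nth_Abs_fps)
qed

section \<open>Coefficients of the partial Zassenhaus products\<close>

lemma zassenhaus_partial_0 [simp]: "zassenhaus_partial Z 0 = 1"
  by (simp add: zassenhaus_partial_def)

lemma zassenhaus_partial_Suc: "zassenhaus_partial Z (Suc N) =
    nsym_exp (fps_const (nsym_scale (1 / of_nat (Suc N)) (Z (Suc N))) * fps_X ^ Suc N) *
    zassenhaus_partial Z N"
proof -
  have "rev [1..<Suc (Suc N)] = Suc N # rev [1..<Suc N]" by simp
  then show ?thesis by (simp only: zassenhaus_partial_def list.map prod_list.Cons)
qed

text \<open>The new factor stands on the left and has coefficients only in the degrees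
  \<open>k * Suc N\<close>, so the Cauchy product collapses to a sum over the exponent
  \<open>k\<close> of \<open>Z (Suc N)\<close>.\<close>

lemma zassenhaus_partial_Suc_nth:
  "fps_nth (zassenhaus_partial Z (Suc N)) n =
    (\<Sum>k | k * Suc N \<le> n. nsym_scale (1 / (of_nat (Suc N) ^ k * fact k))
      (Z (Suc N) ^ k * fps_nth (zassenhaus_partial Z N) (n - k * Suc N)))"
proof -
  let ?E = "nsym_exp (fps_const (nsym_scale (1 / of_nat (Suc N)) (Z (Suc N))) * fps_X ^ Suc N)"
  let ?G = "zassenhaus_partial Z N"
  have E: "fps_nth ?E j = (if Suc N dvd j then nsym_scale (1 / (of_nat (Suc N) ^ (j div Suc N) * fact (j div Suc N)))
      (Z (Suc N) ^ (j div Suc N)) else 0)" for j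
    by (simp only: nsym_exp_nth[OF zero_less_Suc] nsym_scale_exp_term)
  have "fps_nth (zassenhaus_partial Z (Suc N)) n = (\<Sum>j=0..n. fps_nth ?E j * fps_nth ?G (n - j))"
    by (simp only: zassenhaus_partial_Suc fps_mult_nth)
  also have "\<dots> = (\<Sum>j\<in>(\<lambda>k. k * Suc N) ` {k. k * Suc N \<le> n}. fps_nth ?E j * fps_nth ?G (n - j))"
  proof (rule sum.mono_neutral_right)
    show "\<forall>j\<in>{0..n} - (\<lambda>k. k * Suc N) ` {k. k * Suc N \<le> n}. fps_nth ?E j * fps_nth ?G (n - j) = 0"
    proof
      fix j assume j: "j \<in> {0..n} - (\<lambda>k. k * Suc N) ` {k. k * Suc N \<le> n}"
      have "\<not> Suc N dvd j"
      proof
        assume "Suc N dvd j"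
        then obtain k where "j = Suc N * k" by (rule dvdE)
        then have "j = k * Suc N" by (simp only: mult.commute)
        with j show False by auto
      qed
      then show "fps_nth ?E j * fps_nth ?G (n - j) = 0" by (simp only: E) simp
    qed
  qed auto
  also have "\<dots> = (\<Sum>k | k * Suc N \<le> n. fps_nth ?E (k * Suc N) * fps_nth ?G (n - k * Suc N))"
    by (subst sum.reindex) (auto simp: inj_on_def simp del: mult_Suc_right)
  also have "\<dots> = (\<Sum>k | k * Suc N \<le> n. nsym_scale (1 / (of_nat (Suc N) ^ k * fact k))
      (Z (Suc N) ^ k * fps_nth ?G (n - k * Suc N)))"
    unfolding E by (intro sum.cong) (simp_all add: nsym_scale_mult_left del: of_nat_Suc mult_Suc_right)
  finally show ?thesis .
qed

text \<open>A factor of index above \<open>n\<close> affects degree \<open>n\<close> only through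
  its constant term \<open>1\<close>.\<close>

lemma zassenhaus_partial_nth_stable:
  assumes "n \<le> N"
  shows "fps_nth (zassenhaus_partial Z N) n = fps_nth (zassenhaus_partial Z n) n"
  using assms
proof (induction N rule: dec_induct)
  case (step N)
  then have "{k. k * Suc N \<le> n} = {0}"
  proof -
    have "k * Suc N \<le> n \<longleftrightarrow> k = 0" for k
      using step.hyps by (cases k) auto
    then show ?thesis by auto
  qed
  then have "fps_nth (zassenhaus_partial Z (Suc N)) n = fps_nth (zassenhaus_partial Z N) n"
    by (simp only: zassenhaus_partial_Suc_nth) simp
  with step show ?case by simp
qed simp

lemma zassenhaus_partial_nth_0: "fps_nth (zassenhaus_partial Z N) 0 = 1"
  using zassenhaus_partial_nth_stable[of 0 N Z] by simp

text \<open>Only the exponents \<open>0\<close> and \<open>1\<close> fit into degree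
  \<open>Suc N\<close>. Since \<open>Z (Suc N)\<close> enters linearly, the defining equation can be
  solved for it.\<close>

lemma zassenhaus_partial_Suc_nth_diag:
  "fps_nth (zassenhaus_partial Z (Suc N)) (Suc N) =
    fps_nth (zassenhaus_partial Z N) (Suc N) + nsym_scale (1 / of_nat (Suc N)) (Z (Suc N))"
proof -
  have "{k. k * Suc N \<le> Suc N} = {0, 1}"
  proof -
    have "k * Suc N \<le> Suc N \<longleftrightarrow> k = 0 \<or> k = 1" for k
      by (cases k) auto
    then show ?thesis by auto
  qed
  then show ?thesis
    by (simp only: zassenhaus_partial_Suc_nth) (simp add: zassenhaus_partial_nth_0)
qed

text \<open>Convergence means that each coefficient is eventually constant, and by stability
  coefficient \<open>n\<close> is already settled in the \<open>n\<close>-th partial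
  product.\<close>

lemma zassenhaus_partial_tendsto_iff:
  "zassenhaus_partial Z \<longlonglongrightarrow> F \<longleftrightarrow> (\<forall>n. fps_nth (zassenhaus_partial Z n) n = fps_nth F n)"
proof -
  have "(\<forall>\<^sub>F N in sequentially. fps_nth (zassenhaus_partial Z N) n = fps_nth F n) \<longleftrightarrow>
      fps_nth (zassenhaus_partial Z n) n = fps_nth F n" for n
  proof
    assume "\<forall>\<^sub>F N in sequentially. fps_nth (zassenhaus_partial Z N) n = fps_nth F n"
    then obtain N where "\<And>m. m \<ge> N \<Longrightarrow> fps_nth (zassenhaus_partial Z m) n = fps_nth F n"
      by (auto simp: eventually_sequentially)
    from this[of "max N n"] show "fps_nth (zassenhaus_partial Z n) n = fps_nth F n"
      using zassenhaus_partial_nth_stable[of n "max N n" Z] by simp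
  next
    assume "fps_nth (zassenhaus_partial Z n) n = fps_nth F n"
    then have "fps_nth (zassenhaus_partial Z N) n = fps_nth F n" if "N \<ge> n" for N
      using zassenhaus_partial_nth_stable[OF that, of Z] by simp
    then show "\<forall>\<^sub>F N in sequentially. fps_nth (zassenhaus_partial Z N) n = fps_nth F n"
      unfolding eventually_sequentially by blast
  qed
  then show ?thesis
    by (simp add: tendsto_fps_iff)
qed

lemma zassenhaus_partial_cong:
  assumes "\<And>i. 1 \<le> i \<Longrightarrow> i \<le> N \<Longrightarrow> Z i = Z' i"
  shows "zassenhaus_partial Z N = zassenhaus_partial Z' N"
  unfolding zassenhaus_partial_def
  by (rule arg_cong[where f = prod_list], rule map_cong) (auto simp: assms)

section \<open>Weakly decreasing words and their \<open>z\<close>-factors\<close>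

definition dec_lists :: "nat \<Rightarrow> nat \<Rightarrow> nat list set"
  where "dec_lists N n = {xs. sorted_wrt (\<ge>) xs \<and> set xs \<subseteq> {1..N} \<and> sum_list xs = n}"

definition z_list :: "nat list \<Rightarrow> rat"
  where "z_list xs = (\<Prod>i\<in>set xs. of_nat i ^ count_list xs i * fact (count_list xs i))"

text \<open>An absent \<open>i\<close> contributes the factor \<open>1\<close>. Enlarging the index
  set lets several blocks share one product range.\<close>

lemma z_list_superset:
  assumes "finite A" "set xs \<subseteq> A"
  shows "z_list xs = (\<Prod>i\<in>A. of_nat i ^ count_list xs i * fact (count_list xs i))"
  unfolding z_list_def using assms
  by (intro prod.mono_neutral_left) (auto simp: count_list_0_iff)

lemma length_le_sum_list:
  assumes "\<forall>x\<in>set xs. 1 \<le> (x :: nat)"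
  shows "length xs \<le> sum_list xs"
  using assms by (induction xs) auto

lemma finite_positive_lists: "finite {xs. (\<forall>x\<in>set xs. 1 \<le> (x :: nat)) \<and> sum_list xs = n}"
proof (rule finite_subset)
  show "{xs. (\<forall>x\<in>set xs. 1 \<le> x) \<and> sum_list xs = n} \<subseteq> {xs. set xs \<subseteq> {..n} \<and> length xs \<le> n}"
    using length_le_sum_list member_le_sum_list by auto
qed (rule finite_lists_length_le, simp)

lemma finite_dec_lists: "finite (dec_lists N n)"
  by (rule finite_subset[OF _ finite_positive_lists[of n]]) (auto simp: dec_lists_def)

text \<open>All copies of an upper bound stand at the front of a weakly decreasing list. This
  inverts the prepending of copies in the next expansion.\<close>

lemma dec_list_split_max:
  assumes "sorted_wrt (\<ge>) xs" "\<forall>x\<in>set xs. x \<le> (m :: nat)"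
  shows "replicate (count_list xs m) m @ filter (\<lambda>x. x \<noteq> m) xs = xs"
  using assms
proof (induction xs)
  case (Cons x xs)
  show ?case
  proof (cases "x = m")
    case False
    with Cons.prems have "m \<notin> set xs" by auto
    then have "count_list xs m = 0" "filter (\<lambda>x. x \<noteq> m) xs = xs"
      by (auto simp: count_list_0_iff filter_id_conv)
    with False show ?thesis by simp
  qed (use Cons in auto)
qed simp

lemma z_list_replicate_append:
  assumes "m \<notin> set ys"
  shows "z_list (replicate k m @ ys) = of_nat m ^ k * fact k * z_list ys"
proof -
  have cnt: "count_list (replicate k m) i = (if i = m then k else 0)" for i
    by (induction k) auto
  have "z_list (replicate k m @ ys) = (\<Prod>i\<in>insert m (set ys).
      of_nat i ^ count_list (replicate k m @ ys) i * fact (count_list (replicate k m @ ys) i))"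
    by (rule z_list_superset) auto
  also have "\<dots> = of_nat m ^ k * fact k * z_list ys"
  proof -
    have "count_list (replicate k m @ ys) i = count_list ys i" if "i \<in> set ys" for i
      using assms that by (auto simp: cnt)
    moreover have "count_list (replicate k m @ ys) m = k"
      using assms by (simp add: cnt count_list_0_iff)
    ultimately show ?thesis
      using assms by (simp add: z_list_def del: count_list_append)
  qed
  finally show ?thesis .
qed

text \<open>Induction on \<open>N\<close>: choosing the exponent \<open>k\<close> in the new left
  factor prepends \<open>k\<close> copies of \<open>Suc N\<close> to a decreasing list with entries
  at most \<open>N\<close>.\<close>

lemma zassenhaus_partial_nth:
  "fps_nth (zassenhaus_partial Z N) n =
    (\<Sum>xs\<in>dec_lists N n. nsym_scale (1 / z_list xs) (prod_list (map Z xs)))"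
proof (induction N arbitrary: n)
  case 0
  have "dec_lists 0 n = (if n = 0 then {[]} else {})"
    by (auto simp: dec_lists_def)
  then show ?case by (simp add: z_list_def)
next
  case (Suc N)
  let ?K = "{k. k * Suc N \<le> n}"
  let ?g = "\<lambda>xs. nsym_scale (1 / z_list xs) (prod_list (map Z xs))"
  have finK: "finite ?K"
    by (rule finite_subset[of _ "{..n}"]) auto
  have powr: "prod_list (replicate k (Z (Suc N))) = Z (Suc N) ^ k" for k
    by (induction k) simp_all
  have g: "?g (replicate k (Suc N) @ ys) =
      nsym_scale (1 / (of_nat (Suc N) ^ k * fact k)) (Z (Suc N) ^ k * ?g ys)"
    if "ys \<in> dec_lists N (n - k * Suc N)" for k ys
  proof -
    have "Suc N \<notin> set ys" using that by (auto simp: dec_lists_def)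
    then show ?thesis
      by (simp add: z_list_replicate_append powr nsym_scale_mult_right del: of_nat_Suc)
  qed
  have "fps_nth (zassenhaus_partial Z (Suc N)) n =
      (\<Sum>k\<in>?K. \<Sum>ys\<in>dec_lists N (n - k * Suc N). ?g (replicate k (Suc N) @ ys))"
    unfolding zassenhaus_partial_Suc_nth Suc.IH sum_distrib_left nsym.scale_sum_right
    by (intro sum.cong refl) (rule g[symmetric])
  also have "\<dots> = (\<Sum>(k, ys)\<in>Sigma ?K (\<lambda>k. dec_lists N (n - k * Suc N)). ?g (replicate k (Suc N) @ ys))"
    using finK finite_dec_lists by (subst sum.Sigma) auto
  also have "\<dots> = (\<Sum>xs\<in>dec_lists (Suc N) n. ?g xs)"
  proof (rule sum.reindex_bij_witness[where j = "\<lambda>(k, ys). replicate k (Suc N) @ ys"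
        and i = "\<lambda>xs. (count_list xs (Suc N), filter (\<lambda>x. x \<noteq> Suc N) xs)"])
    fix a assume a: "a \<in> Sigma ?K (\<lambda>k. dec_lists N (n - k * Suc N))"
    then obtain k ys where kys: "a = (k, ys)" "k * Suc N \<le> n" "ys \<in> dec_lists N (n - k * Suc N)"
      by auto
    then have notin: "Suc N \<notin> set ys" by (auto simp: dec_lists_def)
    have "count_list (replicate k (Suc N)) (Suc N) = k" by (induction k) auto
    with notin show "(\<lambda>xs. (count_list xs (Suc N), filter (\<lambda>x. x \<noteq> Suc N) xs))
        (case a of (k, ys) \<Rightarrow> replicate k (Suc N) @ ys) = a"
      by (auto simp: kys count_list_0_iff filter_id_conv)
    show "(case a of (k, ys) \<Rightarrow> replicate k (Suc N) @ ys) \<in> dec_lists (Suc N) n"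
    proof -
      have "sorted_wrt (\<ge>) (replicate k (Suc N))" by (induction k) auto
      then show ?thesis
        using kys by (auto simp: dec_lists_def sorted_wrt_append
            sum_list_replicate le_Suc_eq subset_iff simp del: mult_Suc_right)
    qed
    show "?g (case a of (k, ys) \<Rightarrow> replicate k (Suc N) @ ys) =
        (case a of (k, ys) \<Rightarrow> ?g (replicate k (Suc N) @ ys))"
      by (simp add: kys)
  next
    fix xs assume xs: "xs \<in> dec_lists (Suc N) n"
    then have split: "replicate (count_list xs (Suc N)) (Suc N) @ filter (\<lambda>x. x \<noteq> Suc N) xs = xs"
      by (intro dec_list_split_max) (auto simp: dec_lists_def)
    then show "(case (count_list xs (Suc N), filter (\<lambda>x. x \<noteq> Suc N) xs) of
        (k, ys) \<Rightarrow> replicate k (Suc N) @ ys) = xs" by simp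
    have "sum_list xs = count_list xs (Suc N) * Suc N + sum_list (filter (\<lambda>x. x \<noteq> Suc N) xs)"
      by (subst split[symmetric], subst sum_list_append) (simp add: sum_list_replicate)
    then show "(count_list xs (Suc N), filter (\<lambda>x. x \<noteq> Suc N) xs)
        \<in> Sigma ?K (\<lambda>k. dec_lists N (n - k * Suc N))"
      using xs by (auto simp: dec_lists_def le_Suc_eq subset_iff sorted_wrt_filter simp del: mult_Suc_right)
  qed
  finally show ?case .
qed

section \<open>Homogeneity, existence and uniqueness of the Zassenhaus elements\<close>

lemma homogeneous_0 [simp]: "homogeneous n 0"
  by (simp add: homogeneous_def)

lemma homogeneous_add: "homogeneous n F \<Longrightarrow> homogeneous n G \<Longrightarrow> homogeneous n (F + G)"
  using Poly_Mapping.keys_add[of F G] by (auto simp: homogeneous_def)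

lemma homogeneous_scale: "homogeneous n F \<Longrightarrow> homogeneous n (nsym_scale c F)"
  by (auto simp: homogeneous_def in_keys_iff)

lemma homogeneous_diff: "homogeneous n F \<Longrightarrow> homogeneous n G \<Longrightarrow> homogeneous n (F - G)"
  using Poly_Mapping.keys_diff[of F G] by (auto simp: homogeneous_def)

lemma homogeneous_sum: "(\<And>x. x \<in> A \<Longrightarrow> homogeneous n (f x)) \<Longrightarrow> homogeneous n (sum f A)"
  by (induction A rule: infinite_finite_induct) (auto intro: homogeneous_add)

lemma weight_0 [simp]: "weight 0 = 0"
  by (simp add: weight_def zero_composition.rep_eq)

lemma weight_plus [simp]: "weight (\<alpha> + \<beta>) = weight \<alpha> + weight \<beta>"
  by (simp add: weight_def plus_composition.rep_eq)

lemma homogeneous_one: "homogeneous 0 1"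
  by (simp add: homogeneous_def flip: single_one)

lemma homogeneous_mult: "homogeneous m F \<Longrightarrow> homogeneous n G \<Longrightarrow> homogeneous (m + n) (F * G)"
  using Poly_Mapping.keys_mult[of F G] by (force simp: homogeneous_def)

lemma homogeneous_prod_list:
  assumes "\<And>i. i \<in> set xs \<Longrightarrow> homogeneous i (Z i)"
  shows "homogeneous (sum_list xs) (prod_list (map Z xs))"
  using assms by (induction xs) (auto intro: homogeneous_mult homogeneous_one)

lemma homogeneous_S_gen: "homogeneous n (S_gen n)"
  by (cases n) (simp_all add: S_gen_def homogeneous_one, simp add: homogeneous_def weight_def Composition_inverse)

text \<open>The coefficient of \<open>t\<^sup>n\<close> in the Zassenhaus product is \<open>Z n / n\<close> plus an expression in the
  \<open>Z i\<close> with \<open>i < n\<close>.\<close>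

function zassenhaus :: "nat \<Rightarrow> nsym" where
  "zassenhaus n = nsym_scale (of_nat n)
    (S_gen n - fps_nth (zassenhaus_partial (\<lambda>i. if i < n then zassenhaus i else 0) (n - 1)) n)"
  by auto
termination by (relation "measure id") auto

declare zassenhaus.simps [simp del]

lemma zassenhaus_0: "zassenhaus 0 = 0"
  by (subst zassenhaus.simps) simp

lemma zassenhaus_Suc: "zassenhaus (Suc N) = nsym_scale (of_nat (Suc N))
    (S_gen (Suc N) - fps_nth (zassenhaus_partial zassenhaus N) (Suc N))"
proof -
  have "zassenhaus_partial (\<lambda>i. if i < Suc N then zassenhaus i else 0) N
      = zassenhaus_partial zassenhaus N"
    by (rule zassenhaus_partial_cong) simp
  then show ?thesis by (subst zassenhaus.simps) simp
qed

text \<open>The subtracted coefficient is a combination of products over lists of sum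
  \<open>n\<close> with entries below \<open>n\<close>, so strong induction applies.\<close>

lemma homogeneous_zassenhaus: "homogeneous n (zassenhaus n)"
proof (induction n rule: less_induct)
  case (less n)
  show ?case
  proof (cases n)
    case (Suc N)
    have "homogeneous n (fps_nth (zassenhaus_partial zassenhaus N) n)"
      unfolding zassenhaus_partial_nth
    proof (intro homogeneous_sum homogeneous_scale)
      fix xs assume "xs \<in> dec_lists N n"
      then have xs: "sum_list xs = n" "\<And>i. i \<in> set xs \<Longrightarrow> i < n"
        using Suc by (auto simp: dec_lists_def)
      then show "homogeneous n (prod_list (map zassenhaus xs))"
        using homogeneous_prod_list[of xs zassenhaus] less.IH by blast
    qed
    then show ?thesis
      unfolding Suc zassenhaus_Suc
      by (intro homogeneous_scale homogeneous_diff homogeneous_S_gen)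
  qed (simp add: zassenhaus_0)
qed

lemma zassenhaus_partial_zassenhaus: "zassenhaus_partial zassenhaus \<longlonglongrightarrow> Abs_fps S_gen"
  unfolding zassenhaus_partial_tendsto_iff
proof
  fix n show "fps_nth (zassenhaus_partial zassenhaus n) n = fps_nth (Abs_fps S_gen) n"
  proof (cases n)
    case (Suc N)
    show ?thesis
      unfolding Suc zassenhaus_partial_Suc_nth_diag zassenhaus_Suc fps_nth_Abs_fps nsym.scale_scale
      by (simp del: of_nat_Suc)
  qed (simp add: S_gen_def)
qed

text \<open>Coefficient \<open>n\<close> determines \<open>Z n\<close> from the earlier elements.
  The value at \<open>0\<close> enters no factor and is fixed by the first assumption.\<close>

lemma zassenhaus_unique:
  assumes "Z 0 = 0" "zassenhaus_partial Z \<longlonglongrightarrow> Abs_fps S_gen"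
  shows "Z = zassenhaus"
proof
  fix n show "Z n = zassenhaus n"
  proof (induction n rule: less_induct)
    case (less n)
    show ?case
    proof (cases n)
      case (Suc N)
      have "zassenhaus_partial Z N = zassenhaus_partial zassenhaus N"
        using less.IH Suc by (intro zassenhaus_partial_cong) (simp only: less_Suc_eq_le)
      moreover have "fps_nth (zassenhaus_partial Z (Suc N)) (Suc N) = S_gen (Suc N)"
        using assms(2) by (simp add: zassenhaus_partial_tendsto_iff)
      ultimately have "S_gen (Suc N) - fps_nth (zassenhaus_partial zassenhaus N) (Suc N) =
          nsym_scale (1 / of_nat (Suc N)) (Z (Suc N))"
        unfolding zassenhaus_partial_Suc_nth_diag by (simp only: diff_eq_eq add.commute)
      then show ?thesis
        unfolding Suc zassenhaus_Suc by (simp del: of_nat_Suc)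
    qed (simp add: assms zassenhaus_0)
  qed
qed

lemma Z_gen_eq_zassenhaus: "Z_gen = zassenhaus"
  unfolding Z_gen_def
proof (rule the_equality)
  show "zassenhaus 0 = 0 \<and> (\<forall>i\<ge>1. homogeneous i (zassenhaus i)) \<and>
      zassenhaus_partial zassenhaus \<longlonglongrightarrow> Abs_fps S_gen"
    using zassenhaus_0 homogeneous_zassenhaus zassenhaus_partial_zassenhaus by blast
qed (blast intro: zassenhaus_unique)

lemma S_gen_expansion:
  "S_gen n = (\<Sum>xs\<in>dec_lists n n. nsym_scale (1 / z_list xs) (prod_list (map Z_gen xs)))"
  using zassenhaus_partial_zassenhaus
  unfolding zassenhaus_partial_tendsto_iff zassenhaus_partial_nth Z_gen_eq_zassenhaus fps_nth_Abs_fps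
  by (rule allE) (erule sym)

section \<open>Splittings\<close>

lemma parts_pos: "x \<in> set (parts \<alpha>) \<Longrightarrow> 1 \<le> x"
  using parts[of \<alpha>] by simp

lemma parts_0 [simp]: "parts 0 = []"
  by (simp add: zero_composition.rep_eq)

lemma parts_plus [simp]: "parts (\<alpha> + \<beta>) = parts \<alpha> @ parts \<beta>"
  by (simp add: plus_composition.rep_eq)

lemma parts_sum_list: "parts (sum_list as) = concat (map parts as)"
  by (induction as) simp_all

lemma weight_sum_list: "weight (sum_list as) = sum_list (map weight as)"
  by (induction as) simp_all

lemma sum_list_concat: "sum_list (concat xss) = sum_list (map sum_list (xss :: 'a::monoid_add list list))"
  by (induction xss) simp_all

lemma map_weight: "map weight as = map sum_list (map parts as)"
  by (simp add: weight_def)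

lemma parts_Composition: "\<forall>x\<in>set xs. 1 \<le> x \<Longrightarrow> parts (Composition xs) = xs"
  by (simp add: Composition_inverse)

lemma z_coeff_eq_z_list: "z_coeff \<alpha> = z_list (parts \<alpha>)"
  by (simp add: z_coeff_def z_list_def part_mult_def)

lemma z_coeff_pos: "0 < z_coeff \<alpha>"
  unfolding z_coeff_def by (intro prod_pos) (auto dest: parts_pos)

lemma Z_basis_0 [simp]: "Z_basis 0 = 1"
  by (simp add: Z_basis_def)

lemma Z_basis_plus: "Z_basis (\<alpha> + \<beta>) = Z_basis \<alpha> * Z_basis \<beta>"
  by (simp add: Z_basis_def)

definition descending :: "composition \<Rightarrow> bool"
  where "descending \<alpha> \<longleftrightarrow> sorted_wrt (\<ge>) (parts \<alpha>)"

lemma finite_weight_eq: "finite {\<alpha>. weight \<alpha> = n}"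
proof (rule finite_imageD)
  show "finite (parts ` {\<alpha>. weight \<alpha> = n})"
    by (rule finite_subset[OF _ finite_positive_lists[of n]]) (auto simp: weight_def dest: parts_pos)
qed (auto simp: inj_on_def parts_inject)

text \<open>Translation from lists to compositions; the bound \<open>n\<close> on the entries in
  \<open>dec_lists n n\<close> is automatic, since the sum is \<open>n\<close>.\<close>

lemma S_gen_expansion_descending:
  "S_gen n = (\<Sum>\<alpha> | weight \<alpha> = n \<and> descending \<alpha>. nsym_scale (1 / z_coeff \<alpha>) (Z_basis \<alpha>))"
  unfolding S_gen_expansion
proof (rule sum.reindex_bij_witness[where i = parts and j = Composition])
  fix xs assume "xs \<in> dec_lists n n"
  then have xs: "\<forall>x\<in>set xs. 1 \<le> x" "sorted_wrt (\<ge>) xs" "sum_list xs = n"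
    by (auto simp: dec_lists_def)
  then show "parts (Composition xs) = xs" by (simp add: parts_Composition)
  with xs show "Composition xs \<in> {\<alpha>. weight \<alpha> = n \<and> descending \<alpha>}"
    and "nsym_scale (1 / z_coeff (Composition xs)) (Z_basis (Composition xs)) =
      nsym_scale (1 / z_list xs) (prod_list (map Z_gen xs))"
    by (simp_all add: weight_def descending_def z_coeff_eq_z_list Z_basis_def)
next
  fix \<alpha> assume "\<alpha> \<in> {\<alpha>. weight \<alpha> = n \<and> descending \<alpha>}"
  then show "parts \<alpha> \<in> dec_lists n n"
    using member_le_sum_list[of _ "parts \<alpha>"] parts_pos
    by (auto simp: dec_lists_def weight_def descending_def)
qed (simp add: parts_inverse)

text \<open>An element records one choice of term from the expansion of each factor
  \<open>S_gen b\<close>.\<close>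

definition descending_splits :: "nat list \<Rightarrow> composition list set"
  where "descending_splits bs = {as. map weight as = bs \<and> (\<forall>a\<in>set as. descending a)}"

lemma descending_splits_Nil: "descending_splits [] = {[]}"
  by (auto simp: descending_splits_def)

lemma descending_splits_Cons: "descending_splits (b # bs) =
    (\<lambda>(a, as). a # as) ` ({a. weight a = b \<and> descending a} \<times> descending_splits bs)"
  by (auto simp: descending_splits_def image_iff map_eq_Cons_conv)

text \<open>Distributivity: scalars are central, and \<open>Z_basis\<close> turns concatenation into
  multiplication.\<close>

lemma prod_list_S_gen_expansion:
  "prod_list (map S_gen bs) = (\<Sum>as\<in>descending_splits bs.
    nsym_scale (1 / prod_list (map z_coeff as)) (Z_basis (sum_list as)))"
proof (induction bs)
  case (Cons b bs)
  let ?D = "{a. weight a = b \<and> descending a}"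
  let ?h = "\<lambda>as. nsym_scale (1 / prod_list (map z_coeff as)) (Z_basis (sum_list as))"
  have "prod_list (map S_gen (b # bs)) =
      (\<Sum>a\<in>?D. \<Sum>as\<in>descending_splits bs. nsym_scale (1 / z_coeff a) (Z_basis a) * ?h as)"
    by (simp only: list.map prod_list.Cons Cons.IH S_gen_expansion_descending[of b] sum_product)
  also have "\<dots> = (\<Sum>a\<in>?D. \<Sum>as\<in>descending_splits bs. ?h (a # as))"
    by (simp add: nsym_scale_mult_left nsym_scale_mult_right Z_basis_plus mult.commute)
  also have "\<dots> = (\<Sum>p\<in>?D \<times> descending_splits bs. ?h ((\<lambda>(a, as). a # as) p))"
    by (simp add: sum.cartesian_product case_prod_beta)
  also have "\<dots> = (\<Sum>as\<in>descending_splits (b # bs). ?h as)"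
    unfolding descending_splits_Cons by (subst sum.reindex) (auto simp: inj_on_def)
  finally show ?case .
qed (simp add: descending_splits_Nil)

section \<open>Uniqueness of splittings and the refinement order\<close>

text \<open>One of the two prefixes extends the other. The extension has sum \<open>0\<close>, hence
  is empty because the entries are positive.\<close>

lemma sum_list_parts_append_cancel:
  fixes xs ys us vs :: "nat list"
  assumes "xs @ us = ys @ vs" "sum_list xs = sum_list ys" "\<forall>x\<in>set (xs @ us). 1 \<le> x"
  shows "xs = ys \<and> us = vs"
proof -
  have nil: "zs = []" if "sum_list zs = 0" "\<forall>z\<in>set zs. 1 \<le> z" for zs :: "nat list"
    using length_le_sum_list[OF that(2)] that(1) by simp
  from assms(1) obtain zs where "xs = ys @ zs \<and> zs @ us = vs \<or> xs @ zs = ys \<and> us = zs @ vs"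
    by (auto simp: append_eq_append_conv2)
  then show ?thesis
    using assms(2,3) nil[of zs] by auto
qed

lemma composition_plus_cancel:
  assumes "a + x = b + y" "weight a = weight b"
  shows "a = b \<and> x = y"
proof -
  have "parts a = parts b \<and> parts x = parts y"
  proof (rule sum_list_parts_append_cancel)
    show "parts a @ parts x = parts b @ parts y"
      using arg_cong[OF assms(1), of parts] by simp
    show "sum_list (parts a) = sum_list (parts b)"
      using assms(2) by (simp add: weight_def)
  qed (auto dest: parts_pos)
  then show ?thesis by (simp add: parts_inject)
qed

text \<open>The weight of the first block fixes where to cut, and the rest follows by induction.
  This justifies the definite description in \<open>blocks\<close>.\<close>

lemma splitting_unique:
  assumes "splitting \<alpha> \<beta> as" "splitting \<alpha> \<beta> bs"
  shows "as = bs"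
proof -
  have "as = bs" if "sum_list as = sum_list bs" "map weight as = map weight bs" for as bs
    using that
  proof (induction as arbitrary: bs)
    case (Cons a as)
    then obtain b cs where bs: "bs = b # cs" by (cases bs) auto
    with Cons.prems have "a = b \<and> sum_list as = sum_list cs"
      by (intro composition_plus_cancel) auto
    with Cons bs show ?case by auto
  qed simp
  with assms show ?thesis by (simp add: splitting_def)
qed

lemma blocks_eq: "splitting \<alpha> \<beta> as \<Longrightarrow> blocks \<alpha> \<beta> = as"
  unfolding blocks_def using splitting_unique by blast

lemma refines_weight: "refines \<alpha> \<beta> \<Longrightarrow> weight \<alpha> = weight \<beta>"
  by (auto simp: refines_def splitting_def weight_sum_list weight_def[of \<beta>])

lemma splitting_refl: "splitting \<alpha> \<alpha> (map (\<lambda>x. Composition [x]) (parts \<alpha>))"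
proof -
  have P: "parts (Composition [x]) = [x]" if "x \<in> set (parts \<alpha>)" for x
    using parts_pos[OF that] by (simp add: parts_Composition)
  have "map (parts \<circ> (\<lambda>x. Composition [x])) (parts \<alpha>) = map (\<lambda>x. [x]) (parts \<alpha>)"
    by (rule map_cong) (simp_all add: P)
  then have "parts (sum_list (map (\<lambda>x. Composition [x]) (parts \<alpha>))) = parts \<alpha>"
    by (simp only: parts_sum_list list.map_comp) simp
  moreover have "map (weight \<circ> (\<lambda>x. Composition [x])) (parts \<alpha>) = parts \<alpha>"
    by (rule map_idI) (simp add: P weight_def)
  ultimately show ?thesis by (simp add: splitting_def parts_inject)
qed

text \<open>Each nonempty block contributes at least one part. Equality forces single-part blocks,
  and the weight of such a block is its part.\<close>

lemma length_le_concat: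
  assumes "\<forall>a\<in>set as. parts a \<noteq> []"
  shows "length as \<le> length (concat (map parts as)) \<and>
    (length as = length (concat (map parts as)) \<longrightarrow> concat (map parts as) = map weight as)"
  using assms
proof (induction as)
  case (Cons a as)
  then obtain x xs where a: "parts a = x # xs" by (cases "parts a") auto
  have IH: "length as \<le> length (concat (map parts as))"
    "length as = length (concat (map parts as)) \<Longrightarrow> concat (map parts as) = map weight as"
    using Cons by auto
  have len: "length (concat (map parts (a # as))) = Suc (length xs + length (concat (map parts as)))"
    by (simp add: a)
  show ?case
  proof (intro conjI impI)
    show "length (a # as) \<le> length (concat (map parts (a # as)))"
      unfolding len using IH(1) by simp
    assume "length (a # as) = length (concat (map parts (a # as)))"
    then have "xs = []" "length as = length (concat (map parts as))"
      unfolding len using IH(1) by auto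
    with IH(2) a show "concat (map parts (a # as)) = map weight (a # as)"
      by (simp add: weight_def)
  qed
qed simp

lemma splitting_nonempty:
  assumes "splitting \<alpha> \<beta> as" "a \<in> set as"
  shows "parts a \<noteq> []"
proof -
  have "weight a \<in> set (parts \<beta>)"
    using assms by (metis splitting_def image_eqI set_map)
  then show ?thesis
    using parts_pos by (force simp: weight_def)
qed

text \<open>Proper coarsening strictly lowers the number of parts; this is the triangularity behind
  the later inductions.\<close>

lemma refines_length:
  assumes "refines \<alpha> \<beta>" "\<alpha> \<noteq> \<beta>"
  shows "length (parts \<beta>) < length (parts \<alpha>)"
proof -
  from assms(1) obtain as where as: "splitting \<alpha> \<beta> as" by (auto simp: refines_def)
  then have \<alpha>: "parts \<alpha> = concat (map parts as)" and \<beta>: "parts \<beta> = map weight as"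
    by (auto simp: splitting_def parts_sum_list[symmetric])
  have "length as \<le> length (parts \<alpha>) \<and> (length as = length (parts \<alpha>) \<longrightarrow> parts \<alpha> = parts \<beta>)"
    using length_le_concat[of as] splitting_nonempty[OF as] unfolding \<alpha> \<beta> by blast
  moreover have "parts \<alpha> \<noteq> parts \<beta>" using assms(2) by (simp add: parts_inject)
  moreover have "length (parts \<beta>) = length as" by (simp add: \<beta>)
  ultimately show ?thesis by linarith
qed

lemma length_parts_le_weight: "length (parts \<alpha>) \<le> weight \<alpha>"
  using length_le_sum_list[of "parts \<alpha>"] parts_pos by (auto simp: weight_def)

section \<open>Descending runs and the composition \<open>C_comp\<close>\<close>

lemma concat_descending_runs: "concat (descending_runs xs) = xs"
proof (induction xs rule: descending_runs.induct)
  case (3 a b xs)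
  then show ?case by (cases "descending_runs (b # xs)") auto
qed simp_all

lemma descending_runs_eq_Nil_iff: "descending_runs xs = [] \<longleftrightarrow> xs = []"
  by (induction xs rule: descending_runs.induct) auto

text \<open>The recursion of \<open>descending_runs\<close> prepends to the first run of the tail.
  Knowing how that run starts, comparing neighbours suffices for sortedness.\<close>

lemma hd_hd_descending_runs: "xs \<noteq> [] \<Longrightarrow> hd (descending_runs xs) \<noteq> [] \<and> hd (hd (descending_runs xs)) = hd xs"
  by (induction xs rule: descending_runs.induct) auto

lemma descending_runs_sorted:
  "rs \<in> set (descending_runs xs) \<Longrightarrow> rs \<noteq> [] \<and> sorted_wrt (\<ge>) rs"
proof (induction xs arbitrary: rs rule: descending_runs.induct)
  case (3 a b xs)
  obtain r rest where r: "descending_runs (b # xs) = r # rest"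
    using descending_runs_eq_Nil_iff by (metis list.distinct(1) list.exhaust)
  have hd: "r \<noteq> []" "hd r = b"
    using hd_hd_descending_runs[of "b # xs"] r by auto
  show ?case
  proof (cases "a < b")
    case True
    with 3 r show ?thesis by auto
  next
    case False
    have "sorted_wrt (\<ge>) r" using 3(2)[OF False] r by auto
    then have "sorted_wrt (\<ge>) (a # r)"
      using False hd by (cases r) auto
    with False 3 r show ?thesis by auto
  qed
qed simp_all

text \<open>A weakly decreasing block is never broken inside; only the junction with
  \<open>xs\<close> decides whether a new run begins.\<close>

lemma descending_runs_append:
  assumes "as \<noteq> []" "sorted_wrt (\<ge>) as"
  shows "descending_runs (as @ xs) =
    (if xs = [] then [as]
     else if last as < hd xs then as # descending_runs xs
     else (as @ hd (descending_runs xs)) # tl (descending_runs xs))"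
  using assms
proof (induction as rule: descending_runs.induct)
  case (2 a)
  then show ?case by (cases xs) auto
qed auto

text \<open>Runs break only at block boundaries, so each run is a union of consecutive blocks;
  \<open>gss\<close> groups the blocks by run.\<close>

lemma descending_runs_concat:
  assumes "\<forall>as\<in>set ass. as \<noteq> [] \<and> sorted_wrt (\<ge>) as"
  shows "\<exists>gss. concat gss = ass \<and> map concat gss = descending_runs (concat ass)"
  using assms
proof (induction ass)
  case Nil
  then show ?case by (intro exI[of _ "[]"]) simp
next
  case (Cons as ass)
  then obtain gss where gss: "concat gss = ass" "map concat gss = descending_runs (concat ass)"
    by auto
  have as: "as \<noteq> []" "sorted_wrt (\<ge>) as" using Cons.prems by auto
  show ?case
  proof (cases "concat ass = []")
    case True
    then have "ass = []" using Cons.prems by (cases ass) auto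
    then show ?thesis
      using as descending_runs_append[OF as, of "[]"] by (intro exI[of _ "[[as]]"]) simp
  next
    case False
    then obtain g gs where g: "gss = g # gs"
      using gss descending_runs_eq_Nil_iff[of "concat ass"] by (cases gss) auto
    \<comment> \<open>A strict ascent at the junction puts \<open>as\<close> into a group of its
      own; otherwise \<open>as\<close> joins the first group.\<close>
    show ?thesis
    proof (cases "last as < hd (concat ass)")
      case True
      then show ?thesis
        using False gss descending_runs_append[OF as, of "concat ass"]
        by (intro exI[of _ "[as] # gss"]) (simp del: concat_eq_Nil_conv)
    next
      case nlt: False
      then show ?thesis
        using False gss g descending_runs_append[OF as, of "concat ass"]
        by (intro exI[of _ "(as # g) # gs"]) (auto simp: gss(2)[symmetric] simp del: gss(2))
    qed
  qed
qed

text \<open>Runs are nonempty and consist of positive parts, so their sums are positive and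
  \<open>Composition\<close> is applied to a legitimate list.\<close>

lemma parts_C_comp: "parts (C_comp \<alpha>) = map sum_list (descending_runs (parts \<alpha>))"
  unfolding C_comp_def
proof (rule parts_Composition, rule ballI)
  fix x assume "x \<in> set (map sum_list (descending_runs (parts \<alpha>)))"
  then obtain r where r: "r \<in> set (descending_runs (parts \<alpha>))" "x = sum_list r" by auto
  then obtain y where "y \<in> set r" using descending_runs_sorted by (metis last_in_set)
  moreover have "set r \<subseteq> set (parts \<alpha>)"
    using r(1) by (metis concat_descending_runs UN_upper set_concat)
  ultimately show "1 \<le> x"
    using r(2) parts_pos member_le_sum_list[of y r] by fastforce
qed

definition run_blocks :: "composition \<Rightarrow> composition list"
  where "run_blocks \<alpha> = map Composition (descending_runs (parts \<alpha>))"

lemma map_parts_run_blocks: "map parts (run_blocks \<alpha>) = descending_runs (parts \<alpha>)"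
  unfolding run_blocks_def list.map_comp
proof (rule map_idI)
  fix r assume "r \<in> set (descending_runs (parts \<alpha>))"
  then have "set r \<subseteq> set (parts \<alpha>)"
    by (metis concat_descending_runs UN_upper set_concat)
  then show "(parts \<circ> Composition) r = r"
    using parts_pos by (auto intro!: parts_Composition)
qed

lemma splitting_C_comp: "splitting \<alpha> (C_comp \<alpha>) (run_blocks \<alpha>)"
proof -
  have "parts (sum_list (run_blocks \<alpha>)) = parts \<alpha>"
    by (simp add: parts_sum_list map_parts_run_blocks concat_descending_runs)
  moreover have "map weight (run_blocks \<alpha>) = map sum_list (map parts (run_blocks \<alpha>))"
    by (simp add: weight_def)
  ultimately show ?thesis
    by (simp add: splitting_def parts_inject parts_C_comp map_parts_run_blocks del: map_map)
qed

lemma descending_run_blocks: "a \<in> set (run_blocks \<alpha>) \<Longrightarrow> descending a"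
  using descending_runs_sorted map_parts_run_blocks unfolding descending_def
  by (metis image_eqI list.set_map)

text \<open>The parts of \<beta> are the weights of the list \<open>as\<close>, so cutting \<beta>
  into \<open>bs\<close> cuts \<open>as\<close> at the same places into groups
  \<open>ass\<close>.\<close>

lemma splitting_trans:
  assumes "splitting \<alpha> \<beta> as" "splitting \<beta> \<gamma> bs"
  shows "\<exists>ass. concat ass = as \<and> splitting \<alpha> \<gamma> (map sum_list ass)"
proof -
  have ex: "\<exists>ass. concat ass = as \<and> map (map weight) ass = bss"
    if "map weight as = concat bss" for as and bss :: "nat list list"
    using that
  proof (induction bss arbitrary: as)
    case (Cons b bss)
    then obtain us vs where "as = us @ vs" "map weight us = b" "map weight vs = concat bss"
      by (auto simp: map_eq_append_conv)
    with Cons.IH[of vs] obtain ass where "concat ass = vs" "map (map weight) ass = bss" by auto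
    with \<open>as = us @ vs\<close> \<open>map weight us = b\<close> show ?case
      by (intro exI[of _ "us # ass"]) simp
  qed auto
  have "map weight as = concat (map parts bs)"
    using assms by (simp add: splitting_def parts_sum_list[symmetric])
  then obtain ass where ass: "concat ass = as" "map (map weight) ass = map parts bs"
    using ex by blast
  have "map weight (map sum_list ass) = map sum_list (map (map weight) ass)"
    by (simp add: weight_sum_list)
  also have "\<dots> = parts \<gamma>"
    using assms(2) unfolding ass(2) by (simp only: splitting_def map_weight)
  finally have "map weight (map sum_list ass) = parts \<gamma>" .
  then show ?thesis
    using ass(1) assms(1) by (auto simp: splitting_def sum_list_concat)
qed

text \<open>If \<beta> refines \<open>C_comp \<alpha>\<close>, every block lies inside a run of
  \<alpha> and is descending. Conversely, descending blocks are never cut by a run break, so they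
  can be grouped into the runs.\<close>

lemma refines_C_comp_iff:
  assumes "splitting \<alpha> \<beta> as"
  shows "refines \<beta> (C_comp \<alpha>) \<longleftrightarrow> (\<forall>a\<in>set as. descending a)"
proof
  assume "refines \<beta> (C_comp \<alpha>)"
  then obtain bs where "splitting \<beta> (C_comp \<alpha>) bs" by (auto simp: refines_def)
  from splitting_trans[OF assms this] obtain ass
    where ass: "concat ass = as" "splitting \<alpha> (C_comp \<alpha>) (map sum_list ass)" by blast
  \<comment> \<open>Uniqueness of splittings identifies the grouped blocks with the runs of
    \<alpha>.\<close>
  then have runs: "map sum_list ass = run_blocks \<alpha>"
    using splitting_C_comp splitting_unique by blast
  show "\<forall>a\<in>set as. descending a"
  proof
    fix a assume "a \<in> set as"
    then obtain g where g: "g \<in> set ass" "a \<in> set g" using ass(1) by auto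
    then have "descending (sum_list g)"
      using runs descending_run_blocks by (metis image_eqI list.set_map)
    moreover obtain us vs where "g = us @ a # vs" using g(2) by (meson split_list)
    ultimately show "descending a"
      by (simp add: descending_def sorted_wrt_append)
  qed
next
  assume desc: "\<forall>a\<in>set as. descending a"
  have "\<forall>xs\<in>set (map parts as). xs \<noteq> [] \<and> sorted_wrt (\<ge>) xs"
    using desc splitting_nonempty[OF assms] by (auto simp: descending_def)
  from descending_runs_concat[OF this] obtain gss where gss: "concat gss = map parts as"
    "map concat gss = descending_runs (concat (map parts as))" by blast
  have \<alpha>: "concat (map parts as) = parts \<alpha>" and \<beta>: "map sum_list (map parts as) = parts \<beta>"
    using assms by (simp_all only: splitting_def parts_sum_list[symmetric] map_weight)
  \<comment> \<open>Each run yields a block of \<beta>, formed by the sums of the pieces of \<alpha>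
    grouped in that run.\<close>
  define bs where "bs = map (\<lambda>g. Composition (map sum_list g)) gss"
  have "map parts bs = map (map sum_list) gss"
    unfolding bs_def list.map_comp
  proof (rule map_cong[OF refl])
    fix g assume "g \<in> set gss"
    then have "set (map sum_list g) \<subseteq> set (parts \<beta>)"
      unfolding \<beta>[symmetric] gss(1)[symmetric] by auto
    then show "(parts \<circ> (\<lambda>g. Composition (map sum_list g))) g = map sum_list g"
      using parts_pos unfolding comp_def by (intro parts_Composition) blast
  qed
  note bs = this
  have "parts (sum_list bs) = parts \<beta>"
    unfolding parts_sum_list bs \<beta>[symmetric] gss(1)[symmetric] by (simp add: map_concat)
  moreover have "map weight bs = parts (C_comp \<alpha>)"
  proof -
    have "map weight bs = map sum_list (map parts bs)"
      by (simp add: weight_def)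
    also have "\<dots> = map sum_list (map concat gss)"
      unfolding bs by (simp add: comp_def sum_list_concat)
    finally show ?thesis
      by (simp only: gss(2) \<alpha> parts_C_comp)
  qed
  ultimately show "refines \<beta> (C_comp \<alpha>)"
    by (auto simp: refines_def splitting_def parts_inject intro!: exI[of _ bs])
qed

section \<open>The transition matrix\<close>

text \<open>The coefficient of \<open>M_basis \<beta>\<close> in the scaled quasipowersum of
  \<alpha>, extended by zero to all pairs.\<close>

definition quasi_coeff :: "composition \<Rightarrow> composition \<Rightarrow> rat" where
  "quasi_coeff \<alpha> \<beta> =
    (if refines \<alpha> \<beta> \<and> refines \<beta> (C_comp \<alpha>) then C_coeff \<alpha> \<beta> / z_coeff \<alpha> else 0)"

lemma part_mult_sum_list: "part_mult i (sum_list as) = sum_list (map (part_mult i) as)"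
  by (induction as) (simp_all add: part_mult_def)

text \<open>The factorials of the multiplicities in \<alpha> cancel. Multiplicities add over blocks,
  so the remaining powers and factorials are distributed over the blocks as their
  \<open>z_coeff\<close>.\<close>

lemma C_coeff_div_z_coeff:
  assumes "splitting \<alpha> \<beta> as"
  shows "C_coeff \<alpha> \<beta> / z_coeff \<alpha> = 1 / prod_list (map z_coeff as)"
proof -
  let ?I = "set (parts \<alpha>)"
  have \<alpha>: "\<alpha> = sum_list as" using assms by (simp add: splitting_def)
  have "(\<Prod>a\<leftarrow>as. of_nat i ^ part_mult i a * fact (part_mult i a)) =
      (of_nat i ^ part_mult i (sum_list as) * of_nat (\<Prod>a\<leftarrow>as. fact (part_mult i a)) :: rat)" for i as
    unfolding part_mult_sum_list by (induction as) (simp_all add: power_add)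
  then have prod_block: "(\<Prod>a\<leftarrow>as. of_nat i ^ part_mult i a * fact (part_mult i a)) =
      (of_nat i ^ part_mult i \<alpha> * of_nat (c_fact i \<alpha> \<beta>) :: rat)" for i
    unfolding c_fact_def blocks_eq[OF assms] by (simp only: \<alpha>)
  have swap: "(\<Prod>a\<leftarrow>as. \<Prod>i\<in>?I. f i a) = (\<Prod>i\<in>?I. \<Prod>a\<leftarrow>as. f i a)"
    for f :: "nat \<Rightarrow> composition \<Rightarrow> rat" and as
    by (induction as) (simp_all add: prod.distrib)
  have "prod_list (map z_coeff as) =
      (\<Prod>a\<leftarrow>as. \<Prod>i\<in>?I. of_nat i ^ part_mult i a * fact (part_mult i a))"
  proof (rule arg_cong[where f = prod_list], rule map_cong[OF refl])
    fix a assume "a \<in> set as"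
    then have "set (parts a) \<subseteq> ?I"
      unfolding \<alpha> parts_sum_list by auto
    then show "z_coeff a = (\<Prod>i\<in>?I. of_nat i ^ part_mult i a * fact (part_mult i a))"
      unfolding z_coeff_eq_z_list part_mult_def by (intro z_list_superset) auto
  qed
  also have "\<dots> = (\<Prod>i\<in>?I. of_nat i ^ part_mult i \<alpha> * of_nat (c_fact i \<alpha> \<beta>))"
    unfolding swap prod_block ..
  finally have z: "prod_list (map z_coeff as) =
    (\<Prod>i\<in>?I. of_nat i ^ part_mult i \<alpha> * of_nat (c_fact i \<alpha> \<beta>))" .
  have "C_coeff \<alpha> \<beta> / z_coeff \<alpha> = (\<Prod>i\<in>?I. 1 / (of_nat i ^ part_mult i \<alpha> * of_nat (c_fact i \<alpha> \<beta>)))"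
    unfolding C_coeff_def z_coeff_def prod_dividef[symmetric]
    by (intro prod.cong) simp_all
  then show ?thesis
    unfolding z by (simp add: prod_dividef)
qed

text \<open>The terms of the multiplied-out product are reindexed by the concatenation of their
  blocks. This is injective by uniqueness of splittings, and \<open>refines_C_comp_iff\<close>
  identifies its image.\<close>

lemma S_basis_expansion:
  "S_basis \<beta> = (\<Sum>\<alpha> | refines \<alpha> \<beta>. nsym_scale (quasi_coeff \<alpha> \<beta>) (Z_basis \<alpha>))"
proof -
  let ?D = "descending_splits (parts \<beta>)"
  have split: "splitting (sum_list as) \<beta> as" if "as \<in> ?D" for as
    using that by (simp add: descending_splits_def splitting_def)
  have inj: "inj_on sum_list ?D"
    using split splitting_unique by (metis inj_onI)
  have image: "sum_list ` ?D = {\<alpha>. refines \<alpha> \<beta> \<and> refines \<beta> (C_comp \<alpha>)}"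
  proof (intro equalityI subsetI)
    fix \<alpha> assume "\<alpha> \<in> sum_list ` ?D"
    then obtain as where as: "as \<in> ?D" "\<alpha> = sum_list as" by blast
    then have "refines \<beta> (C_comp \<alpha>)"
      using refines_C_comp_iff[OF split[OF as(1)]] by (simp add: descending_splits_def)
    with split[OF as(1)] as(2) show "\<alpha> \<in> {\<alpha>. refines \<alpha> \<beta> \<and> refines \<beta> (C_comp \<alpha>)}"
      by (auto simp: refines_def)
  next
    fix \<alpha> assume "\<alpha> \<in> {\<alpha>. refines \<alpha> \<beta> \<and> refines \<beta> (C_comp \<alpha>)}"
    then have "refines \<alpha> \<beta>" and C: "refines \<beta> (C_comp \<alpha>)" by simp_all
    then obtain as where as: "splitting \<alpha> \<beta> as" by (auto simp: refines_def)
    have "\<forall>a\<in>set as. descending a"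
      using C refines_C_comp_iff[OF as] by blast
    with as have "as \<in> ?D" "\<alpha> = sum_list as"
      by (auto simp: descending_splits_def splitting_def)
    then show "\<alpha> \<in> sum_list ` ?D" by blast
  qed
  have fin: "finite {\<alpha>. refines \<alpha> \<beta>}"
    by (rule finite_subset[OF _ finite_weight_eq[of "weight \<beta>"]]) (auto dest: refines_weight)
  have "S_basis \<beta> = (\<Sum>as\<in>?D. nsym_scale (quasi_coeff (sum_list as) \<beta>) (Z_basis (sum_list as)))"
    unfolding S_basis_def prod_list_S_gen_expansion
  proof (rule sum.cong[OF refl])
    fix as assume as: "as \<in> ?D"
    then have "sum_list as \<in> {\<alpha>. refines \<alpha> \<beta> \<and> refines \<beta> (C_comp \<alpha>)}"
      unfolding image[symmetric] by (rule imageI)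
    then show "nsym_scale (1 / prod_list (map z_coeff as)) (Z_basis (sum_list as)) =
        nsym_scale (quasi_coeff (sum_list as) \<beta>) (Z_basis (sum_list as))"
      by (simp add: quasi_coeff_def C_coeff_div_z_coeff[OF split[OF as]])
  qed
  also have "\<dots> = (\<Sum>\<alpha> | refines \<alpha> \<beta> \<and> refines \<beta> (C_comp \<alpha>). nsym_scale (quasi_coeff \<alpha> \<beta>) (Z_basis \<alpha>))"
    unfolding image[symmetric] by (simp add: sum.reindex[OF inj])
  also have "\<dots> = (\<Sum>\<alpha> | refines \<alpha> \<beta>. nsym_scale (quasi_coeff \<alpha> \<beta>) (Z_basis \<alpha>))"
    by (rule sum.mono_neutral_left[OF fin]) (auto simp: quasi_coeff_def)
  finally show ?thesis .
qed

text \<open>Single-part blocks are descending, so the diagonal pair qualifies, and its value is the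
  reciprocal of a product of positive numbers.\<close>

lemma quasi_coeff_diag: "0 < quasi_coeff \<alpha> \<alpha>"
proof -
  let ?as = "map (\<lambda>x. Composition [x]) (parts \<alpha>)"
  have "descending (Composition [x])" if "x \<in> set (parts \<alpha>)" for x
    using parts_pos[OF that] by (simp add: descending_def parts_Composition)
  then have "refines \<alpha> (C_comp \<alpha>)"
    using refines_C_comp_iff[OF splitting_refl[of \<alpha>]] by auto
  moreover have "refines \<alpha> \<alpha>"
    using splitting_refl by (auto simp: refines_def)
  moreover have "0 < prod_list (map z_coeff as)" for as
    by (induction as) (simp_all add: z_coeff_pos)
  ultimately show ?thesis
    by (simp add: quasi_coeff_def C_coeff_div_z_coeff[OF splitting_refl] del: map_map)
qed

lemma quasi_coeff_nonzeroD: "quasi_coeff \<alpha> \<beta> \<noteq> 0 \<Longrightarrow> refines \<alpha> \<beta>"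
  by (auto simp: quasi_coeff_def split: if_splits)

section \<open>Duality\<close>

text \<open>The functional \<open>\<phi> i\<close> vanishes on the span of the other vectors but is
  \<open>1\<close> on \<open>b i\<close>. Applied later to both families, with their roles
  exchanged.\<close>

lemma (in vector_space) dual_family_independent:
  fixes b :: "'i \<Rightarrow> 'b" and \<phi> :: "'i \<Rightarrow> 'b \<Rightarrow> 'a"
  assumes add: "\<And>i x y. \<phi> i (x + y) = \<phi> i x + \<phi> i y"
    and scale: "\<And>i c x. \<phi> i (scale c x) = c * \<phi> i x"
    and dual: "\<And>i j. \<phi> i (b j) = (if i = j then 1 else 0)"
  shows "inj b" and "independent (range b)"
proof -
  show "inj b"
  proof (rule injI)
    fix i j assume "b i = b j"
    then have "\<phi> i (b i) = \<phi> i (b j)" by simp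
    then show "i = j" by (simp add: dual split: if_splits)
  qed
  have zero: "\<phi> i 0 = 0" for i
    using scale[of i 0 0] by simp
  show "independent (range b)"
    unfolding dependent_def
  proof
    assume "\<exists>a\<in>range b. a \<in> span (range b - {a})"
    then obtain i where i: "b i \<in> span (range b - {b i})" by blast
    have "span (range b - {b i}) \<subseteq> {x. \<phi> i x = 0}"
    proof (rule span_minimal)
      show "range b - {b i} \<subseteq> {x. \<phi> i x = 0}"
        by (auto simp: dual)
      show "subspace {x. \<phi> i x = 0}"
        by (simp add: subspace_def zero add scale)
    qed
    with i have "\<phi> i (b i) = 0" by blast
    then show False by (simp add: dual)
  qed
qed

section \<open>Coordinates in the monomial basis\<close>

definition M_coord :: "composition \<Rightarrow> series \<Rightarrow> rat"
  where "M_coord \<alpha> G = G (monom_at \<alpha> [0..<length (parts \<alpha>)])"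

lemma M_coord_0: "M_coord \<alpha> 0 = 0"
  by (simp add: M_coord_def)

lemma M_coord_add: "M_coord \<alpha> (F + G) = M_coord \<alpha> F + M_coord \<alpha> G"
  by (simp add: M_coord_def)

lemma M_coord_scale: "M_coord \<alpha> (series_scale c G) = c * M_coord \<alpha> G"
  by (simp add: M_coord_def series_scale_def)

lemma M_coord_sum: "M_coord \<alpha> (sum f A) = (\<Sum>x\<in>A. M_coord \<alpha> (f x))"
  by (induction A rule: infinite_finite_induct) (simp_all add: M_coord_add, simp_all add: M_coord_def)

lemma M_coord_M_basis: "M_coord \<alpha> (M_basis \<beta>) = (if \<beta> = \<alpha> then 1 else 0)"
  by (simp add: M_coord_def M_basis_monom_at[OF index_seqs_nonempty])

text \<open>Reading off one coefficient is linear on all series. It agrees with the basis coordinate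
  on each \<open>M_basis \<beta>\<close>, hence on the span.\<close>

lemma representation_M_basis:
  assumes "G \<in> series.span (range M_basis)"
  shows "series.representation (range M_basis) G (M_basis \<alpha>) = M_coord \<alpha> G"
proof -
  have "G \<in> series.span (range M_basis) \<and>
      series.representation (range M_basis) G (M_basis \<alpha>) = M_coord \<alpha> G"
    using assms
  proof (induction rule: series.span_induct_alt)
    case base
    show ?case
      by (intro conjI series.span_zero) (simp only: series.representation_zero M_coord_0)
  next
    case (step c x y)
    then obtain \<beta> where x: "x = M_basis \<beta>" by blast
    have xs: "x \<in> series.span (range M_basis)" using x series.span_base by blast
    have cx: "series_scale c x \<in> series.span (range M_basis)" by (rule series.span_scale[OF xs])
    have y: "y \<in> series.span (range M_basis)"
      "series.representation (range M_basis) y (M_basis \<alpha>) = M_coord \<alpha> y"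
      using step by auto
    have "series.representation (range M_basis) x (M_basis \<alpha>) = M_coord \<alpha> x"
      using inj_M_basis
      by (simp add: x series.representation_basis[OF independent_M_basis] M_coord_M_basis inj_eq)
    with y(2) have "series.representation (range M_basis) (series_scale c x + y) (M_basis \<alpha>) =
        M_coord \<alpha> (series_scale c x + y)"
      by (simp only: series.representation_add[OF independent_M_basis y(1) cx]
          series.representation_scale[OF independent_M_basis xs] M_coord_add M_coord_scale)
    with series.span_add[OF cx y(1)] show ?case by blast
  qed
  then show ?thesis ..
qed

text \<open>Refinement preserves weight, so the sum can run over a finite index set depending only
  on the weight; the added coefficients are zero.\<close>

lemma scaled_quasipowersum_eq:
  "scaled_quasipowersum \<alpha> =
    (\<Sum>\<beta> | weight \<beta> = weight \<alpha>. series_scale (quasi_coeff \<alpha> \<beta>) (M_basis \<beta>))"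
proof -
  have "scaled_quasipowersum \<alpha> = (\<Sum>\<beta> | refines \<alpha> \<beta> \<and> refines \<beta> (C_comp \<alpha>).
      series_scale (quasi_coeff \<alpha> \<beta>) (M_basis \<beta>))"
    unfolding scaled_quasipowersum_def quasipowersum_def series.scale_sum_right
    by (intro sum.cong) (simp_all add: quasi_coeff_def)
  also have "\<dots> = (\<Sum>\<beta> | weight \<beta> = weight \<alpha>. series_scale (quasi_coeff \<alpha> \<beta>) (M_basis \<beta>))"
    by (rule sum.mono_neutral_left[OF finite_weight_eq])
      (auto simp: quasi_coeff_def dest: refines_weight)
  finally show ?thesis .
qed

lemma M_coord_scaled_quasipowersum: "M_coord \<beta> (scaled_quasipowersum \<alpha>) = quasi_coeff \<alpha> \<beta>"
proof -
  have "M_coord \<beta> (scaled_quasipowersum \<alpha>) =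
      (\<Sum>\<gamma> | weight \<gamma> = weight \<alpha>. if \<gamma> = \<beta> then quasi_coeff \<alpha> \<gamma> else 0)"
    unfolding scaled_quasipowersum_eq M_coord_sum M_coord_scale M_coord_M_basis
    by (intro sum.cong) auto
  also have "\<dots> = quasi_coeff \<alpha> \<beta>"
  proof -
    have "quasi_coeff \<alpha> \<beta> = 0" if "weight \<beta> \<noteq> weight \<alpha>"
      using that quasi_coeff_nonzeroD refines_weight by metis
    then show ?thesis
      by (simp add: sum.delta[OF finite_weight_eq])
  qed
  finally show ?thesis .
qed

lemma scaled_quasipowersum_in_span: "scaled_quasipowersum \<alpha> \<in> series.span (range M_basis)"
  unfolding scaled_quasipowersum_eq
  by (intro series.span_sum series.span_scale series.span_base) blast

section \<open>The pairing and the duality relation\<close>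

definition dual_pairing :: "nsym \<Rightarrow> series \<Rightarrow> rat" where
  "dual_pairing F G =
    (\<Sum>\<alpha>\<in>Poly_Mapping.keys F. Poly_Mapping.lookup F \<alpha> * M_coord \<alpha> G)"

text \<open>With \<open>M_coord\<close> in place of the basis representation, the form is bilinear
  on all series, so linearity needs no membership conditions.\<close>

lemma pairing_eq_dual_pairing:
  "G \<in> series.span (range M_basis) \<Longrightarrow> pairing F G = dual_pairing F G"
  by (simp add: pairing_def dual_pairing_def representation_M_basis)

lemma dual_pairing_superset:
  assumes "finite A" "Poly_Mapping.keys F \<subseteq> A"
  shows "dual_pairing F G = (\<Sum>\<alpha>\<in>A. Poly_Mapping.lookup F \<alpha> * M_coord \<alpha> G)"
  unfolding dual_pairing_def using assms
  by (intro sum.mono_neutral_left) (auto simp: in_keys_iff)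

lemma dual_pairing_add_left: "dual_pairing (F + F') G = dual_pairing F G + dual_pairing F' G"
proof -
  let ?A = "Poly_Mapping.keys F \<union> Poly_Mapping.keys F'"
  have "dual_pairing F'' G = (\<Sum>\<alpha>\<in>?A. Poly_Mapping.lookup F'' \<alpha> * M_coord \<alpha> G)"
    if "F'' \<in> {F, F', F + F'}" for F''
    using that Poly_Mapping.keys_add[of F F'] by (intro dual_pairing_superset) auto
  then show ?thesis
    by (simp add: lookup_add algebra_simps sum.distrib)
qed

lemma dual_pairing_scale_left: "dual_pairing (nsym_scale c F) G = c * dual_pairing F G"
proof -
  have "dual_pairing (nsym_scale c F) G =
      (\<Sum>\<alpha>\<in>Poly_Mapping.keys F. Poly_Mapping.lookup (nsym_scale c F) \<alpha> * M_coord \<alpha> G)"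
    by (intro dual_pairing_superset) (auto simp: in_keys_iff)
  then show ?thesis
    by (simp add: dual_pairing_def sum_distrib_left mult.assoc)
qed

lemma dual_pairing_sum_left: "dual_pairing (sum f A) G = (\<Sum>x\<in>A. dual_pairing (f x) G)"
  by (induction A rule: infinite_finite_induct)
    (simp_all add: dual_pairing_add_left, simp_all add: dual_pairing_def)

lemma dual_pairing_add_right: "dual_pairing F (G + G') = dual_pairing F G + dual_pairing F G'"
  by (simp add: dual_pairing_def M_coord_add algebra_simps sum.distrib)

lemma dual_pairing_scale_right: "dual_pairing F (series_scale c G) = c * dual_pairing F G"
  by (simp add: dual_pairing_def M_coord_scale sum_distrib_left mult.left_commute)

lemma dual_pairing_S_basis: "dual_pairing (S_basis \<alpha>) G = M_coord \<alpha> G"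
  by (simp add: dual_pairing_def S_basis_eq_single)

text \<open>Pairing the expansion of \<open>S_basis \<gamma>\<close> with the quasipowersum gives a
  triangular system. By induction all terms except the one for \<gamma> are known, and its
  coefficient is nonzero.\<close>

lemma dual_pairing_Z_basis:
  "dual_pairing (Z_basis \<gamma>) (scaled_quasipowersum \<alpha>) = (if \<gamma> = \<alpha> then 1 else 0)"
\<comment> \<open>A proper refinement keeps the weight and has more parts, so the measure drops;
  truncation does no harm, as the length never exceeds the weight.\<close>
proof (induction "weight \<gamma> - length (parts \<gamma>)" arbitrary: \<gamma> rule: less_induct)
  case less
  let ?R = "{\<delta>. refines \<delta> \<gamma>}"
  let ?d = "\<lambda>\<delta>. if \<delta> = \<alpha> then 1 else 0 :: rat"
  have fin: "finite ?R"
    by (rule finite_subset[OF _ finite_weight_eq[of "weight \<gamma>"]]) (auto dest: refines_weight)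
  have mem: "\<gamma> \<in> ?R"
    using quasi_coeff_nonzeroD[of \<gamma> \<gamma>] quasi_coeff_diag[of \<gamma>] by simp
  have IH: "dual_pairing (Z_basis \<delta>) (scaled_quasipowersum \<alpha>) = ?d \<delta>" if "\<delta> \<in> ?R - {\<gamma>}" for \<delta>
  proof -
    have "weight \<delta> = weight \<gamma>" "length (parts \<gamma>) < length (parts \<delta>)"
      using that refines_weight refines_length by auto
    then show ?thesis
      using length_parts_le_weight[of \<delta>] by (intro less) linarith
  qed
  have expand: "quasi_coeff \<alpha> \<gamma> = (\<Sum>\<delta>\<in>?R. quasi_coeff \<delta> \<gamma> *
      dual_pairing (Z_basis \<delta>) (scaled_quasipowersum \<alpha>))"
    using M_coord_scaled_quasipowersum[of \<gamma> \<alpha>]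
    unfolding dual_pairing_S_basis[symmetric] S_basis_expansion dual_pairing_sum_left
      dual_pairing_scale_left by (rule sym)
  \<comment> \<open>If \<alpha> is not in the index set, it does not refine \<gamma>, and both sides
    are \<open>0\<close>.\<close>
  have "quasi_coeff \<alpha> \<gamma> = (\<Sum>\<delta>\<in>?R. if \<delta> = \<alpha> then quasi_coeff \<delta> \<gamma> else 0)"
    using quasi_coeff_nonzeroD[of \<alpha> \<gamma>] by (auto simp: sum.delta[OF fin])
  also have "\<dots> = (\<Sum>\<delta>\<in>?R. quasi_coeff \<delta> \<gamma> * ?d \<delta>)"
    by (intro sum.cong) auto
  finally have "(\<Sum>\<delta>\<in>?R. quasi_coeff \<delta> \<gamma> * dual_pairing (Z_basis \<delta>) (scaled_quasipowersum \<alpha>)) =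
      (\<Sum>\<delta>\<in>?R. quasi_coeff \<delta> \<gamma> * ?d \<delta>)"
    using expand by simp
  moreover have "(\<Sum>\<delta>\<in>?R - {\<gamma>}. quasi_coeff \<delta> \<gamma> * dual_pairing (Z_basis \<delta>) (scaled_quasipowersum \<alpha>)) =
      (\<Sum>\<delta>\<in>?R - {\<gamma>}. quasi_coeff \<delta> \<gamma> * ?d \<delta>)"
    by (rule sum.cong[OF refl]) (simp only: IH)
  ultimately have "quasi_coeff \<gamma> \<gamma> * dual_pairing (Z_basis \<gamma>) (scaled_quasipowersum \<alpha>) =
      quasi_coeff \<gamma> \<gamma> * ?d \<gamma>"
    unfolding sum.remove[OF fin mem] by (simp only: add_right_cancel)
  then show ?case
    using quasi_coeff_diag[of \<gamma>] by simp
qed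

lemma span_Z_basis: "nsym.span (range Z_basis) = UNIV"
proof -
  have "F \<in> nsym.span (range Z_basis)" for F
  proof -
    have "S_basis \<alpha> \<in> nsym.span (range Z_basis)" for \<alpha>
      unfolding S_basis_expansion
      by (intro nsym.span_sum nsym.span_scale nsym.span_base) blast
    then have "(\<Sum>\<alpha>\<in>Poly_Mapping.keys F. nsym_scale (Poly_Mapping.lookup F \<alpha>) (S_basis \<alpha>))
        \<in> nsym.span (range Z_basis)"
      by (intro nsym.span_sum nsym.span_scale)
    moreover have "nsym_scale c (S_basis \<alpha>) = Poly_Mapping.single \<alpha> c" for c \<alpha>
      by (simp add: S_basis_eq_single nsym_scale_def)
    ultimately show ?thesis
      by (simp add: poly_mapping_sum_single)
  qed
  then show ?thesis by blast
qed

section \<open>Quasisymmetric functions\<close>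

lemma monom_degree_superset:
  assumes "finite A" "Poly_Mapping.keys m \<subseteq> A"
  shows "monom_degree m = (\<Sum>i\<in>A. Poly_Mapping.lookup m i)"
  unfolding monom_degree_def using assms
  by (intro sum.mono_neutral_left) (auto simp: in_keys_iff)

lemma monom_degree_add: "monom_degree (m + m') = monom_degree m + monom_degree m'"
proof -
  let ?A = "Poly_Mapping.keys m \<union> Poly_Mapping.keys m'"
  have "monom_degree m'' = (\<Sum>i\<in>?A. Poly_Mapping.lookup m'' i)" if "m'' \<in> {m, m', m + m'}" for m''
    using that Poly_Mapping.keys_add[of m m'] by (intro monom_degree_superset) auto
  then show ?thesis
    by (simp add: lookup_add sum.distrib)
qed

lemma monom_degree_monom_at:
  assumes "is \<in> index_seqs \<alpha>"
  shows "monom_degree (monom_at \<alpha> is) = weight \<alpha>"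
proof -
  have single: "monom_degree (Poly_Mapping.single i a) = a" for i a
    by (simp add: monom_degree_def)
  have "monom_degree (sum_list (map2 Poly_Mapping.single is as)) = sum_list as"
    if "length is = length as" for "is" as
    using that
    by (induction "is" as rule: list_induct2)
      (simp_all add: monom_degree_add single, simp add: monom_degree_def)
  then show ?thesis
    using assms by (simp add: index_seqs_def monom_at_def weight_def)
qed

text \<open>The sorted support supplies the indices and the exponents there supply the composition.
  Hence a series is determined by its values at the \<open>monom_at\<close>.\<close>

lemma monom_at_surj: "\<exists>\<alpha>. \<exists>is\<in>index_seqs \<alpha>. m = monom_at \<alpha> is"
proof -
  let ?is = "sorted_list_of_set (Poly_Mapping.keys m)"
  let ?as = "map (Poly_Mapping.lookup m) ?is"
  have "\<forall>a\<in>set ?as. 1 \<le> a"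
    by (auto simp: in_keys_iff Suc_le_eq)
  then have as: "parts (Composition ?as) = ?as" by (rule parts_Composition)
  have "monom_at (Composition ?as) ?is =
      sum_list (map (\<lambda>i. Poly_Mapping.single i (Poly_Mapping.lookup m i)) ?is)"
    unfolding monom_at_def as by (simp add: zip_map2 zip_same_conv_map comp_def)
  also have "\<dots> = (\<Sum>i\<in>Poly_Mapping.keys m. Poly_Mapping.single i (Poly_Mapping.lookup m i))"
    by (simp add: sum_list_distinct_conv_sum_set)
  finally have "m = monom_at (Composition ?as) ?is"
    by (simp only: poly_mapping_sum_single)
  moreover have "?is \<in> index_seqs (Composition ?as)"
    unfolding index_seqs_def as by simp
  ultimately show ?thesis by blast
qed

lemma M_basis_in_QSym: "M_basis \<alpha> \<in> QSym"
proof -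
  have "monom_degree m \<le> weight \<alpha>" if "M_basis \<alpha> m \<noteq> 0" for m
  proof -
    obtain \<beta> "is" where m: "is \<in> index_seqs \<beta>" "m = monom_at \<beta> is"
      using monom_at_surj by blast
    then have "\<alpha> = \<beta>"
      using that M_basis_monom_at[OF m(1), of \<alpha>] by (auto split: if_splits)
    then show ?thesis using m by (simp add: monom_degree_monom_at)
  qed
  then show ?thesis
    unfolding QSym_def by (auto simp: M_basis_monom_at)
qed

section \<open>Two spanning families of \<open>QSym\<close>\<close>

lemma subspace_QSym: "series.subspace QSym"
proof (rule series.subspaceI)
  show "0 \<in> QSym" by (simp add: QSym_def)
next
  fix f g assume f: "f \<in> QSym" and g: "g \<in> QSym"
  obtain d e where "\<And>m. f m \<noteq> 0 \<Longrightarrow> monom_degree m \<le> d" "\<And>m. g m \<noteq> 0 \<Longrightarrow> monom_degree m \<le> e"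
    using f g by (auto simp: QSym_def)
  then have "(f + g) m \<noteq> 0 \<Longrightarrow> monom_degree m \<le> max d e" for m
    by (metis add_0_left plus_fun_apply le_max_iff_disj)
  then have "\<exists>d. \<forall>m. (f + g) m \<noteq> 0 \<longrightarrow> monom_degree m \<le> d" by blast
  moreover have "\<forall>\<alpha>. \<forall>is\<in>index_seqs \<alpha>. \<forall>js\<in>index_seqs \<alpha>.
      (f + g) (monom_at \<alpha> is) = (f + g) (monom_at \<alpha> js)"
    using f g unfolding QSym_def mem_Collect_eq plus_fun_apply by metis
  ultimately show "f + g \<in> QSym"
    unfolding QSym_def by blast
next
  fix c f assume "f \<in> QSym"
  then show "series_scale c f \<in> QSym"
    unfolding QSym_def mem_Collect_eq series_scale_def by (metis mult_zero_right)
qed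

lemma sum_fun_at: "(\<Sum>x\<in>A. f x) m = (\<Sum>x\<in>A. (f x :: series) m)"
  by (induction A rule: infinite_finite_induct) simp_all

lemma finite_weight_le: "finite {\<alpha>. weight \<alpha> \<le> d}"
proof -
  have "{\<alpha>. weight \<alpha> \<le> d} = (\<Union>n\<in>{..d}. {\<alpha>. weight \<alpha> = n})" by auto
  then show ?thesis using finite_weight_eq by simp
qed

text \<open>The degree bound makes the expansion finite, and quasisymmetry lets each coefficient be
  read off at the initial indices used by \<open>M_coord\<close>.\<close>

lemma span_M_basis: "series.span (range M_basis) = QSym"
proof
  show "series.span (range M_basis) \<subseteq> QSym"
    by (rule series.span_minimal) (auto simp: M_basis_in_QSym subspace_QSym)
  show "QSym \<subseteq> series.span (range M_basis)"
  proof
    fix f assume f: "f \<in> QSym"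
    then obtain d where d: "\<And>m. f m \<noteq> 0 \<Longrightarrow> monom_degree m \<le> d"
      by (auto simp: QSym_def)
    have "f = (\<Sum>\<beta> | weight \<beta> \<le> d. series_scale (M_coord \<beta> f) (M_basis \<beta>))"
    proof
      fix m
      obtain \<alpha> "is" where m: "is \<in> index_seqs \<alpha>" "m = monom_at \<alpha> is"
        using monom_at_surj by blast
      have fm: "f m = M_coord \<alpha> f"
        using f m index_seqs_nonempty[of \<alpha>] unfolding QSym_def M_coord_def by blast
      have "(\<Sum>\<beta> | weight \<beta> \<le> d. series_scale (M_coord \<beta> f) (M_basis \<beta>)) m =
          (\<Sum>\<beta> | weight \<beta> \<le> d. if \<beta> = \<alpha> then M_coord \<beta> f else 0)"
        unfolding sum_fun_at series_scale_def m(2)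
        by (intro sum.cong) (auto simp: M_basis_monom_at[OF m(1)])
      also have "\<dots> = f m"
        using d[of m] m fm
        by (auto simp: sum.delta[OF finite_weight_le] monom_degree_monom_at)
      finally show "f m = (\<Sum>\<beta> | weight \<beta> \<le> d. series_scale (M_coord \<beta> f) (M_basis \<beta>)) m" ..
    qed
    also have "\<dots> \<in> series.span (range M_basis)"
      by (intro series.span_sum series.span_scale series.span_base) blast
    finally show "f \<in> series.span (range M_basis)" .
  qed
qed

text \<open>Besides \<open>M_basis \<alpha>\<close>, only monomial functions of compositions with
  fewer parts occur in the quasipowersum of \<alpha>, so it can be solved for
  \<open>M_basis \<alpha>\<close> by induction on the length.\<close>

lemma M_basis_in_span_scaled_quasipowersum:
  "M_basis \<alpha> \<in> series.span (range scaled_quasipowersum)"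
proof (induction "length (parts \<alpha>)" arbitrary: \<alpha> rule: less_induct)
  case less
  let ?W = "{\<beta>. weight \<beta> = weight \<alpha>}"
  let ?rest = "\<Sum>\<beta>\<in>?W - {\<alpha>}. series_scale (quasi_coeff \<alpha> \<beta>) (M_basis \<beta>)"
  have "?rest \<in> series.span (range scaled_quasipowersum)"
  proof (rule series.span_sum)
    fix \<beta> assume \<beta>: "\<beta> \<in> ?W - {\<alpha>}"
    show "series_scale (quasi_coeff \<alpha> \<beta>) (M_basis \<beta>) \<in> series.span (range scaled_quasipowersum)"
    proof (cases "quasi_coeff \<alpha> \<beta> = 0")
      case True
      then show ?thesis by (simp add: series.span_zero)
    next
      case False
      then have "length (parts \<beta>) < length (parts \<alpha>)"
        using \<beta> quasi_coeff_nonzeroD refines_length by blast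
      then show ?thesis by (intro series.span_scale less)
    qed
  qed
  moreover have "scaled_quasipowersum \<alpha> \<in> series.span (range scaled_quasipowersum)"
    by (rule series.span_base) blast
  ultimately have "series_scale (1 / quasi_coeff \<alpha> \<alpha>) (scaled_quasipowersum \<alpha> - ?rest)
      \<in> series.span (range scaled_quasipowersum)"
    by (intro series.span_scale series.span_diff)
  moreover have "scaled_quasipowersum \<alpha> = series_scale (quasi_coeff \<alpha> \<alpha>) (M_basis \<alpha>) + ?rest"
    unfolding scaled_quasipowersum_eq by (rule sum.remove[OF finite_weight_eq]) simp
  then have "scaled_quasipowersum \<alpha> - ?rest = series_scale (quasi_coeff \<alpha> \<alpha>) (M_basis \<alpha>)"
    by (simp only: add_diff_cancel_right')
  ultimately show ?case
    using quasi_coeff_diag[of \<alpha>] by simp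
qed

lemma span_scaled_quasipowersum: "series.span (range scaled_quasipowersum) = QSym"
proof
  show "series.span (range scaled_quasipowersum) \<subseteq> QSym"
    using scaled_quasipowersum_in_span subspace_QSym
    by (intro series.span_minimal) (auto simp: span_M_basis)
  show "QSym \<subseteq> series.span (range scaled_quasipowersum)"
    unfolding span_M_basis[symmetric]
    by (rule series.span_minimal)
      (auto simp: M_basis_in_span_scaled_quasipowersum series.subspace_span)
qed

theorem theorem4:
  shows "basis_family series_scale QSym scaled_quasipowersum \<and>
    basis_family nsym_scale UNIV Z_basis \<and>
    (\<forall>\<alpha> \<beta>. pairing (Z_basis \<alpha>) (scaled_quasipowersum \<beta>) = (if \<alpha> = \<beta> then 1 else 0))"
proof (intro conjI allI)
  \<comment> \<open>Pairing with the Zassenhaus elements supplies the dual functionals for the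
    quasipowersums; further below the roles are reversed.\<close>
  note P = series.dual_family_independent[of "\<lambda>\<alpha>. dual_pairing (Z_basis \<alpha>)" scaled_quasipowersum,
      OF dual_pairing_add_right dual_pairing_scale_right dual_pairing_Z_basis]
  show "basis_family series_scale QSym scaled_quasipowersum"
    unfolding basis_family_def using P span_scaled_quasipowersum by blast
  have dual: "dual_pairing (Z_basis \<beta>) (scaled_quasipowersum \<alpha>) = (if \<alpha> = \<beta> then 1 else 0)" for \<alpha> \<beta>
    by (simp add: dual_pairing_Z_basis)
  note Z = nsym.dual_family_independent[of "\<lambda>\<alpha> F. dual_pairing F (scaled_quasipowersum \<alpha>)" Z_basis,
      OF dual_pairing_add_left dual_pairing_scale_left dual]
  show "basis_family nsym_scale UNIV Z_basis"
    unfolding basis_family_def using Z span_Z_basis by blast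
  show "pairing (Z_basis \<alpha>) (scaled_quasipowersum \<beta>) = (if \<alpha> = \<beta> then 1 else 0)" for \<alpha> \<beta>
    by (simp only: pairing_eq_dual_pairing[OF scaled_quasipowersum_in_span] dual_pairing_Z_basis)
qed

end
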